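(* There exists a non-metrizable manifold $M$, with all ends short, such that the space of ends $\mathcal E(M)$ is second countable. Moreover, $\mathcal E(M)$ is a Cantor space (i.e., $M$ can be found with $\mathcal E(M)$ homeomorphic to the Cantor set).
   Context: A manifold is a connected Hausdorff space $M$ for which there is an integer $n\ge 1$ such that every point has an open neighborhood homeomorphic to $\mathbb R^n$; second countability is NOT assumed. Freudenthal compactification. Let $X$ be a locally compact Hausdorff space without isolated points. A subset of $X$ is bounded if it is contained in a compact subset of $X$, and unbounded otherwise; for $U$ open, $\partial(U)=\mathrm{cl}_X(U)\setminus U$. Let $\mathscr K(X)$ be the set of finite pairwise-disjoint collections $\mathscr U=\{U_0,\dots,U_n\}$ of open subsets of $X$, with a distinguished element $U_0$, such that $U_0$ is bounded, every $\partial(U_i)$ is compact, and $X=U_0\cup\bigcup_{i=1}^n\mathrm{cl}_X(U_i)$ with this union disjoint. Put $P_{\mathscr U}=\{\{x\}\mid x\in U_0\}\cup\{\mathrm{cl}_X(U_i)\mid 1\le i\le n\}$, a partition of $X$, and order $\mathscr K(X)$ by $\mathscr U\le\mathscr V$ iff $P_{\mathscr V}$ refines $P_{\mathscr U}$; this is a directed set. Let $X_{\mathscr U}$ be the quotient space of $X$ by $P_{\mathscr U}$ (compact Hausdorff), with the natural maps $X_{\mathscr V}\to X_{\mathscr U}$ for $\mathscr U\le\mathscr V$. The Freudenthal compactification $\mathcal F(X)$ is the inverse limit of this system; it is a compact Hausdorff space containing $X$ as a dense open subspace. The space of ends is $\mathcal E(X)=\mathcal F(X)\setminus X$; its points are the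 ends of $X$. An end of $X$ is short if it is a $G_\delta$ point of $\mathcal F(X)$. *)

theory Defs
  imports "HOL-Analysis.Analysis"
begin

section \<open>Manifolds\<close>

text \<open>Second countability is deliberately not required.\<close>

definition manifold_space :: "'a topology \<Rightarrow> bool" where
  "manifold_space M \<longleftrightarrow>
     connected_space M \<and> Hausdorff_space M \<and>
     (\<exists>n\<ge>1. \<forall>x\<in>topspace M. \<exists>U. openin M U \<and> x \<in> U \<and>
        subtopology M U homeomorphic_space Euclidean_space n)"


section \<open>Quotients by partitions\<close>

definition block_of :: "'a set set \<Rightarrow> 'a \<Rightarrow> 'a set" where
  "block_of P x = (THE B. B \<in> P \<and> x \<in> B)"

definition partition_space :: "'a topology \<Rightarrow> 'a set set \<Rightarrow> 'a set topology" where
  "partition_space X P = topology (\<lambda>\<W>. \<W> \<subseteq> P \<and> openin X (\<Union>\<W>))"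

text \<open>If the partition \<open>Q\<close> refines \<open>P\<close>, every block of \<open>Q\<close> is sent to the block of \<open>P\<close>
  containing it.\<close>

definition coarsen :: "'a set set \<Rightarrow> 'a set \<Rightarrow> 'a set" where
  "coarsen P B = (THE C. C \<in> P \<and> B \<subseteq> C)"

lemma block_of_eq:
  assumes "partition_on A P" "B \<in> P" "x \<in> B"
  shows "block_of P x = B"
  unfolding block_of_def
  using assms by (intro the_equality) (auto simp: partition_on_def disjoint_def)

lemma block_of_in:
  assumes "partition_on A P" "x \<in> A"
  shows "block_of P x \<in> P" "x \<in> block_of P x"
proof -
  obtain B where "B \<in> P" "x \<in> B"
    using assms by (auto simp: partition_on_def)
  then show "block_of P x \<in> P" "x \<in> block_of P x"
    using block_of_eq[OF assms(1)] by auto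
qed

lemma coarsen_eq:
  assumes "partition_on A P" "C \<in> P" "B \<subseteq> C" "B \<noteq> {}"
  shows "coarsen P B = C"
  unfolding coarsen_def
proof (intro the_equality)
  show "C \<in> P \<and> B \<subseteq> C"
    using assms by simp
  show "D = C" if "D \<in> P \<and> B \<subseteq> D" for D
    using assms that disjointD[of P D C] by (auto simp: partition_on_def)
qed

lemma openin_partition_space:
  assumes "partition_on (topspace X) P"
  shows "openin (partition_space X P) \<W> \<longleftrightarrow> \<W> \<subseteq> P \<and> openin X (\<Union>\<W>)"
proof -
  have *: "\<Union>(S \<inter> T) = \<Union>S \<inter> \<Union>T" if "S \<subseteq> P" "T \<subseteq> P" for S T
  proof
    show "\<Union>S \<inter> \<Union>T \<subseteq> \<Union>(S \<inter> T)"
    proof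
      fix x assume "x \<in> \<Union>S \<inter> \<Union>T"
      then obtain B C where "B \<in> S" "x \<in> B" "C \<in> T" "x \<in> C"
        by blast
      moreover from this have "B = C"
        using block_of_eq[OF assms] that by (metis subsetD)
      ultimately show "x \<in> \<Union>(S \<inter> T)"
        by blast
    qed
  qed blast
  have "istopology (\<lambda>\<W>. \<W> \<subseteq> P \<and> openin X (\<Union>\<W>))"
    unfolding istopology_def
  proof (intro conjI allI impI)
    fix S T assume "S \<subseteq> P \<and> openin X (\<Union>S)" "T \<subseteq> P \<and> openin X (\<Union>T)"
    then show "S \<inter> T \<subseteq> P" "openin X (\<Union>(S \<inter> T))"
      using *[of S T] by (auto simp: le_infI1 openin_Int)
  next
    fix \<K> assume \<K>: "\<forall>K\<in>\<K>. K \<subseteq> P \<and> openin X (\<Union>K)"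
    then show "\<Union>\<K> \<subseteq> P"
      by auto
    have "\<Union>(\<Union>\<K>) = (\<Union>K\<in>\<K>. \<Union>K)"
      by auto
    moreover have "openin X (\<Union>K\<in>\<K>. \<Union>K)"
      by (rule openin_Union) (use \<K> in blast)
    ultimately show "openin X (\<Union>(\<Union>\<K>))"
      by simp
  qed
  then show ?thesis
    by (simp add: partition_space_def topology_inverse')
qed

lemma topspace_partition_space:
  assumes "partition_on (topspace X) P"
  shows "topspace (partition_space X P) = P"
proof -
  have "openin (partition_space X P) P"
    using assms by (metis openin_partition_space openin_topspace order_refl partition_onD1)
  moreover have "topspace (partition_space X P) \<subseteq> P"
    using openin_partition_space[OF assms] openin_topspace by blast
  ultimately show ?thesis
    by (simp add: openin_subset subset_antisym)
qed

lemma quotient_map_block_of: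
  assumes P: "partition_on (topspace X) P"
  shows "quotient_map X (partition_space X P) (block_of P)"
proof -
  have "block_of P ` topspace X = P"
  proof
    show "block_of P ` topspace X \<subseteq> P"
      using block_of_in[OF P] by auto
    show "P \<subseteq> block_of P ` topspace X"
    proof
      fix B assume B: "B \<in> P"
      then obtain x where "x \<in> B"
        using P unfolding partition_on_def by fastforce
      moreover have "x \<in> topspace X"
        using B \<open>x \<in> B\<close> P by (auto simp: partition_on_def)
      ultimately show "B \<in> block_of P ` topspace X"
        using block_of_eq[OF P B] by (metis imageI)
    qed
  qed
  moreover have "{x \<in> topspace X. block_of P x \<in> \<W>} = \<Union>\<W>" if "\<W> \<subseteq> P" for \<W>
  proof (intro set_eqI iffI)
    fix x assume "x \<in> {x \<in> topspace X. block_of P x \<in> \<W>}"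
    then show "x \<in> \<Union>\<W>"
      using block_of_in[OF P] by auto
  next
    fix x assume "x \<in> \<Union>\<W>"
    then obtain B where B: "B \<in> \<W>" "x \<in> B"
      by auto
    then have "x \<in> topspace X"
      using that P by (auto simp: partition_on_def)
    then show "x \<in> {x \<in> topspace X. block_of P x \<in> \<W>}"
      using B that block_of_eq[OF P, of B x] by auto
  qed
  ultimately show ?thesis
    unfolding quotient_map_def
    by (simp add: topspace_partition_space[OF P] openin_partition_space[OF P])
qed


section \<open>The Freudenthal compactification\<close>

text \<open>A collection \<open>{U\<^sub>0, \<dots>, U\<^sub>n}\<close> with distinguished element \<open>U\<^sub>0\<close> is encoded as the pair
  \<open>(U\<^sub>0, {U\<^sub>1, \<dots>, U\<^sub>n})\<close>. The set \<open>U\<^sub>0\<close> may be empty and \<open>n\<close> may be \<open>0\<close>, but \<open>U\<^sub>1, \<dots>, U\<^sub>n\<close>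
  are nonempty, since their closures are to be blocks of a partition.\<close>

type_synonym 'a end_cover = "'a set \<times> 'a set set"

definition bounded_in :: "'a topology \<Rightarrow> 'a set \<Rightarrow> bool" where
  "bounded_in X S \<longleftrightarrow> (\<exists>K. compactin X K \<and> S \<subseteq> K)"

definition end_covers :: "'a topology \<Rightarrow> 'a end_cover set" where
  "end_covers X = {(U0, \<U>).
     finite \<U> \<and> {} \<notin> \<U> \<and> U0 \<notin> \<U> \<and> disjoint (insert U0 \<U>) \<and>
     (\<forall>U\<in>insert U0 \<U>. openin X U \<and> compactin X (X closure_of U - U)) \<and>
     bounded_in X U0 \<and>
     topspace X = U0 \<union> (\<Union>U\<in>\<U>. X closure_of U) \<and>
     (\<forall>U\<in>\<U>. disjnt U0 (X closure_of U)) \<and>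
     (\<forall>U\<in>\<U>. \<forall>V\<in>\<U>. U \<noteq> V \<longrightarrow> disjnt (X closure_of U) (X closure_of V))}"

definition cover_partition :: "'a topology \<Rightarrow> 'a end_cover \<Rightarrow> 'a set set" where
  "cover_partition X u = (\<lambda>x. {x}) ` fst u \<union> (\<lambda>U. X closure_of U) ` snd u"

lemma partition_on_cover_partition:
  assumes "u \<in> end_covers X"
  shows "partition_on (topspace X) (cover_partition X u)"
proof -
  obtain U0 \<U> where u: "u = (U0, \<U>)"
    by (cases u)
  have cl: "\<forall>U\<in>\<U>. \<forall>V\<in>\<U>. U \<noteq> V \<longrightarrow> disjnt (X closure_of U) (X closure_of V)"
    using assms by (simp add: u end_covers_def)
  have "X closure_of U \<noteq> {}" if "U \<in> \<U>" for U
    using that assms closure_of_subset[of U X] openin_subset[of X U]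
    by (auto simp: u end_covers_def)
  moreover have "\<Union>(cover_partition X u) = topspace X"
    using assms by (auto simp: u end_covers_def cover_partition_def)
  moreover have "disjoint (cover_partition X u)"
  proof -
    have "disjnt (X closure_of U) (X closure_of V)"
      if "U \<in> \<U>" "V \<in> \<U>" "X closure_of U \<noteq> X closure_of V" for U V
      using that cl by metis
    moreover have "disjnt {x} (X closure_of U)" "disjnt (X closure_of U) {x}"
      if "x \<in> U0" "U \<in> \<U>" for x U
      using that assms by (auto simp: u end_covers_def disjnt_iff)
    ultimately show ?thesis
      by (auto simp: u cover_partition_def pairwise_def)
  qed
  ultimately show ?thesis
    by (auto simp: partition_on_def u cover_partition_def)
qed

text \<open>The order on covers: \<open>u \<le> v\<close> iff the partition of \<open>v\<close> refines that of \<open>u\<close>.\<close>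

definition cover_le :: "'a topology \<Rightarrow> 'a end_cover \<Rightarrow> 'a end_cover \<Rightarrow> bool" where
  "cover_le X u v \<longleftrightarrow> refines (topspace X) (cover_partition X v) (cover_partition X u)"

definition inverse_limit ::
  "'i set \<Rightarrow> ('i \<Rightarrow> 'i \<Rightarrow> bool) \<Rightarrow> ('i \<Rightarrow> 'b topology) \<Rightarrow> ('i \<Rightarrow> 'i \<Rightarrow> 'b \<Rightarrow> 'b) \<Rightarrow> ('i \<Rightarrow> 'b) topology"
  where
  "inverse_limit I le Y f =
     subtopology (product_topology Y I) {p. \<forall>i\<in>I. \<forall>j\<in>I. le i j \<longrightarrow> f i j (p j) = p i}"

definition freudenthal :: "'a topology \<Rightarrow> ('a end_cover \<Rightarrow> 'a set) topology" where
  "freudenthal X =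
     inverse_limit (end_covers X) (cover_le X)
       (\<lambda>u. partition_space X (cover_partition X u))
       (\<lambda>u v. coarsen (cover_partition X u))"

text \<open>The canonical map embedding \<open>X\<close> into its Freudenthal compactification.\<close>

definition freudenthal_embed :: "'a topology \<Rightarrow> 'a \<Rightarrow> ('a end_cover \<Rightarrow> 'a set)" where
  "freudenthal_embed X x = (\<lambda>u\<in>end_covers X. block_of (cover_partition X u) x)"

lemma freudenthal_embed_in:
  assumes x: "x \<in> topspace X"
  shows "freudenthal_embed X x \<in> topspace (freudenthal X)"
proof -
  have "coarsen (cover_partition X u) (block_of (cover_partition X v) x)
          = block_of (cover_partition X u) x"
    if uv: "u \<in> end_covers X" "v \<in> end_covers X" "cover_le X u v" for u v
  proof -
    note pu = partition_on_cover_partition[OF uv(1)]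
    note pv = partition_on_cover_partition[OF uv(2)]
    obtain C where C: "C \<in> cover_partition X u" "block_of (cover_partition X v) x \<subseteq> C"
      using uv(3) block_of_in[OF pv x] by (auto simp: cover_le_def refines_def)
    have "coarsen (cover_partition X u) (block_of (cover_partition X v) x) = C"
      using coarsen_eq[OF pu C] block_of_in[OF pv x] by auto
    moreover have "block_of (cover_partition X u) x = C"
      using block_of_eq[OF pu C(1)] C(2) block_of_in[OF pv x] by auto
    ultimately show ?thesis
      by simp
  qed
  then show ?thesis
    using x block_of_in(1)[OF partition_on_cover_partition]
    by (auto simp: freudenthal_def inverse_limit_def freudenthal_embed_def
        topspace_partition_space partition_on_cover_partition)
qed


section \<open>Ends\<close>

definition ends :: "'a topology \<Rightarrow> ('a end_cover \<Rightarrow> 'a set) set" where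
  "ends X = topspace (freudenthal X) - freudenthal_embed X ` topspace X"

definition end_space :: "'a topology \<Rightarrow> ('a end_cover \<Rightarrow> 'a set) topology" where
  "end_space X = subtopology (freudenthal X) (ends X)"

definition short_end :: "'a topology \<Rightarrow> ('a end_cover \<Rightarrow> 'a set) \<Rightarrow> bool" where
  "short_end X e \<longleftrightarrow> e \<in> ends X \<and> gdelta_in (freudenthal X) {e}"

definition Cantor_space :: "(nat \<Rightarrow> bool) topology" where
  "Cantor_space = product_topology (\<lambda>_. discrete_topology UNIV) UNIV"

end

theory Submission
  imports Defs
begin

text \<open>Remove from the Riemann sphere a Cantor set on the real line, and at each point \<open>p\<close> of the Cantor
  set glue in a half-plane as in the Pruefer surface, whose boundary line parametrizes the rays at \<open>p\<close>
  into the upper half-plane. A small disc around \<open>p\<close>, without a compact rectangle of the chart at \<open>p\<close>,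
  is connected: above the real axis it is joined to the lower half-disc through a gap of the Cantor set,
  and the remainder of the half-plane at \<open>p\<close> is joined to the rays of small slope. As these sets have
  compact frontier up to other cells and shrink to nothing, each of them determines a single end, which
  is a \<open>G\<^sub>\<delta>\<close> point; so the ends form a Cantor set. The surface is not metrizable because the upper
  half-plane is separable but has an uncountable discrete set in its closure, one point for each \<open>p\<close>.\<close>

text \<open>The sphere without a Cantor set already has a Cantor set of short ends, but it is
  metrizable. The half-planes destroy metrizability, and the difficulty is that they must not change
  the ends: a glued half-plane is not compact and could carry ends of its own, so its outer part has
  to belong to the end at \<open>p\<close>. The rectangles \<open>plug k n\<close> exhaust the chart
  at \<open>p\<close>, so what remains after removing them shrinks to nothing. Only the upper side
  is blown up: the plug cuts the upper half-disc into a left and a right part, and the untouched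
  lower half-disc reunites them. A disconnected remainder could split one point \<open>p\<close>
  into several ends. A connected tail settles the value of a thread at every cover: a cover misses
  only a compact set, a late tail avoids this set and lies in a single member. The locale
  \<open>cantor_tails\<close> isolates this argument, so that for the surface mainly planar
  estimates remain.\<close>

section \<open>Ends of Hausdorff spaces\<close>

text \<open>A cover is determined by \<open>U\<^sub>1, \<dots>, U\<^sub>n\<close>, because \<open>U\<^sub>0\<close> is the complement of their closures;
  the conditions on the boundaries and on \<open>U\<^sub>0\<close> then say that \<open>U\<^sub>1, \<dots>, U\<^sub>n\<close> miss only a compact set.\<close>

definition end_family :: "'a topology \<Rightarrow> 'a set set \<Rightarrow> bool" where
  "end_family X \<W> \<longleftrightarrow>
     finite \<W> \<and> {} \<notin> \<W> \<and> (\<forall>W\<in>\<W>. openin X W) \<and>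
     (\<forall>V\<in>\<W>. \<forall>W\<in>\<W>. V \<noteq> W \<longrightarrow> disjnt (X closure_of V) (X closure_of W)) \<and>
     compactin X (topspace X - \<Union>\<W>)"

lemma end_familyD:
  assumes "end_family X \<W>"
  shows "finite \<W>" "{} \<notin> \<W>" "\<And>W. W \<in> \<W> \<Longrightarrow> openin X W"
    "\<And>V W. V \<in> \<W> \<Longrightarrow> W \<in> \<W> \<Longrightarrow> V \<noteq> W \<Longrightarrow> disjnt (X closure_of V) (X closure_of W)"
    "compactin X (topspace X - \<Union>\<W>)"
  using assms unfolding end_family_def by metis+

lemma end_family_subset_closure:
  assumes "end_family X \<W>" "W \<in> \<W>"
  shows "W \<subseteq> X closure_of W" "W \<noteq> {}"
  using end_familyD[OF assms(1)] assms(2) closure_of_subset openin_subset by metis+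

definition family_cover :: "'a topology \<Rightarrow> 'a set set \<Rightarrow> 'a end_cover" where
  "family_cover X \<W> = (topspace X - (\<Union>W\<in>\<W>. X closure_of W), \<W>)"

lemma snd_family_cover [simp]: "snd (family_cover X \<W>) = \<W>"
  by (simp add: family_cover_def)

text \<open>Boundaries are compact as closed subsets of the compact complement of the union of the
  family: the boundary of a member misses that member and, the closures being disjoint, every other
  member.\<close>

lemma family_cover_in_end_covers:
  assumes X: "Hausdorff_space X" and W: "end_family X \<W>"
  shows "family_cover X \<W> \<in> end_covers X"
proof -
  define U0 where "U0 = topspace X - (\<Union>W\<in>\<W>. X closure_of W)"
  note w = end_familyD[OF W]
  let ?C = "topspace X - \<Union>\<W>"
  have clo: "W \<subseteq> X closure_of W" if "W \<in> \<W>" for W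
    using end_family_subset_closure[OF W that] by simp
  have clt: "X closure_of W \<subseteq> topspace X" for W
    by (rule closure_of_subset_topspace)
  have opU0: "openin X U0"
    unfolding U0_def using w(1) by (intro openin_diff closedin_Union) auto
  have U0C: "U0 \<subseteq> ?C"
    using clo by (auto simp: U0_def)
  have cpt: "compactin X (X closure_of U - U)" if "openin X U" "X closure_of U - U \<subseteq> ?C" for U
    by (rule closed_compactin[OF w(5) that(2)]) (simp add: closedin_diff that(1))
  have "closedin X ?C"
    using w(3) by (intro closedin_diff closedin_topspace openin_Union)
  then have "X closure_of U0 \<subseteq> ?C"
    using U0C by (rule closure_of_minimal[rotated])
  then have c0: "compactin X (X closure_of U0 - U0)"
    using opU0 cpt by blast
  have c1: "compactin X (X closure_of W - W)" if "W \<in> \<W>" for W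
  proof (rule cpt)
    show "openin X W" using that w(3) by simp
    have "X closure_of W \<inter> V = {}" if "V \<in> \<W>" "V \<noteq> W" for V
    proof -
      have "disjnt (X closure_of W) (X closure_of V)" using w(4) that \<open>W \<in> \<W>\<close> by simp
      then show ?thesis using clo[OF that(1)] unfolding disjnt_def by blast
    qed
    then show "X closure_of W - W \<subseteq> ?C"
      using clt[of W] by blast
  qed
  \<comment> \<open>If \<open>U0\<close> were a member, it would be disjoint from its own closure,
    hence empty.\<close>
  have "U0 \<inter> X closure_of U0 = {}" if "U0 \<in> \<W>"
    using that unfolding U0_def by blast
  then have "U0 \<notin> \<W>"
    using clo[of U0] w(2) by (metis inf.absorb_iff1)
  moreover have "disjoint (insert U0 \<W>)"
  proof -
    have "disjnt V W" if "V \<in> \<W>" "W \<in> \<W>" "V \<noteq> W" for V W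
    proof -
      have "disjnt (X closure_of V) (X closure_of W)" using w(4) that by simp
      then show ?thesis using clo that unfolding disjnt_def by blast
    qed
    moreover have "disjnt U0 W" "disjnt W U0" if "W \<in> \<W>" for W
      using that clo[OF that] by (auto simp: U0_def disjnt_def)
    ultimately show ?thesis
      by (auto simp: pairwise_def)
  qed
  moreover have "topspace X = U0 \<union> (\<Union>W\<in>\<W>. X closure_of W)"
    using clt by (auto simp: U0_def)
  moreover have "disjnt U0 (X closure_of W)" if "W \<in> \<W>" for W
    using that by (auto simp: U0_def disjnt_def)
  moreover have "bounded_in X U0"
    unfolding bounded_in_def using w(5) U0C by blast
  ultimately show ?thesis
    unfolding family_cover_def end_covers_def U0_def[symmetric]
    using w(1-4) opU0 c0 c1 by (simp add: split_beta)
qed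

text \<open>The complement of the union of \<open>snd u\<close> is closed and lies in a compact set
  containing \<open>U0\<close>, enlarged by the finitely many compact boundaries.\<close>

lemma end_coversD:
  assumes X: "Hausdorff_space X" and u: "u \<in> end_covers X"
  shows "end_family X (snd u)" "u = family_cover X (snd u)"
proof -
  obtain U0 \<W> where uu: "u = (U0, \<W>)" by (cases u)
  have a: "finite \<W>" "{} \<notin> \<W>" "\<And>U. U \<in> insert U0 \<W> \<Longrightarrow> openin X U"
    "\<And>U. U \<in> insert U0 \<W> \<Longrightarrow> compactin X (X closure_of U - U)" "bounded_in X U0"
    "topspace X = U0 \<union> (\<Union>U\<in>\<W>. X closure_of U)" "\<And>U. U \<in> \<W> \<Longrightarrow> disjnt U0 (X closure_of U)"
    "\<forall>U\<in>\<W>. \<forall>V\<in>\<W>. U \<noteq> V \<longrightarrow> disjnt (X closure_of U) (X closure_of V)"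
    using u by (auto simp: uu end_covers_def)
  obtain K where K: "compactin X K" "U0 \<subseteq> K"
    using a(5) by (auto simp: bounded_in_def)
  have "compactin X (K \<union> (\<Union>U\<in>\<W>. X closure_of U - U))"
    using K a by (intro compactin_Un compactin_Union) auto
  moreover have "closedin X (topspace X - \<Union>\<W>)"
    using a(3) by (intro closedin_diff closedin_topspace openin_Union) auto
  moreover have "topspace X - \<Union>\<W> \<subseteq> K \<union> (\<Union>U\<in>\<W>. X closure_of U - U)"
    using a K by auto
  ultimately have "compactin X (topspace X - \<Union>\<W>)"
    using closed_compactin by blast
  then show "end_family X (snd u)"
    using a by (simp add: uu end_family_def)
  have "U0 = topspace X - (\<Union>U\<in>\<W>. X closure_of U)"
    using a(6,7) by (auto simp: disjnt_def)
  then show "u = family_cover X (snd u)"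
    by (simp add: uu family_cover_def)
qed

section \<open>Common refinements of covers\<close>

definition family_meet :: "'a set set \<Rightarrow> 'a set set \<Rightarrow> 'a set set" where
  "family_meet \<V> \<W> = {V \<inter> W | V W. V \<in> \<V> \<and> W \<in> \<W>} - {{}}"

text \<open>Different intersections differ in some factor, and the closures of the two versions of
  that factor are already disjoint. The new complement is the union of the two old ones.\<close>

lemma end_family_meet:
  assumes V: "end_family X \<V>" and W: "end_family X \<W>"
  shows "end_family X (family_meet \<V> \<W>)"
proof -
  note v = end_familyD[OF V] and w = end_familyD[OF W]
  have "family_meet \<V> \<W> \<subseteq> (\<lambda>(V, W). V \<inter> W) ` (\<V> \<times> \<W>)"
    by (auto simp: family_meet_def)
  then have "finite (family_meet \<V> \<W>)"
    using finite_subset finite_imageI[OF finite_cartesian_product] v(1) w(1) by metis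
  moreover have disj: "disjnt (X closure_of (V \<inter> W)) (X closure_of (V' \<inter> W'))"
    if "V \<in> \<V>" "V' \<in> \<V>" "W \<in> \<W>" "W' \<in> \<W>" "V \<inter> W \<noteq> V' \<inter> W'" for V V' W W'
  proof -
    have "X closure_of (V \<inter> W) \<subseteq> X closure_of V" "X closure_of (V \<inter> W) \<subseteq> X closure_of W"
      "X closure_of (V' \<inter> W') \<subseteq> X closure_of V'" "X closure_of (V' \<inter> W') \<subseteq> X closure_of W'"
      by (simp_all add: closure_of_mono)
    moreover have "disjnt (X closure_of V) (X closure_of V') \<or> disjnt (X closure_of W) (X closure_of W')"
      using v(4) w(4) that by metis
    ultimately show ?thesis
      unfolding disjnt_def by blast
  qed
  moreover have "compactin X (topspace X - \<Union>(family_meet \<V> \<W>))"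
  proof -
    have "topspace X - \<Union>(family_meet \<V> \<W>) = (topspace X - \<Union>\<V>) \<union> (topspace X - \<Union>\<W>)"
      by (auto simp: family_meet_def)
    then show ?thesis
      using v(5) w(5) by (simp add: compactin_Un)
  qed
  moreover have "openin X Z" if Z: "Z \<in> family_meet \<V> \<W>" for Z
  proof -
    obtain V W where "V \<in> \<V>" "W \<in> \<W>" "Z = V \<inter> W"
      using Z unfolding family_meet_def by blast
    then show ?thesis using v(3) w(3) by (simp add: openin_Int)
  qed
  moreover have "disjnt (X closure_of Y) (X closure_of Z)"
    if YZ: "Y \<in> family_meet \<V> \<W>" "Z \<in> family_meet \<V> \<W>" "Y \<noteq> Z" for Y Z
  proof -
    obtain V W V' W' where "V \<in> \<V>" "W \<in> \<W>" "Y = V \<inter> W" "V' \<in> \<V>" "W' \<in> \<W>" "Z = V' \<inter> W'"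
      using YZ(1,2) unfolding family_meet_def by blast
    then show ?thesis using disj[of V V' W W'] YZ(3) by simp
  qed
  moreover have "{} \<notin> family_meet \<V> \<W>"
    by (simp add: family_meet_def)
  ultimately show ?thesis
    unfolding end_family_def by simp
qed

text \<open>Only the large blocks need a hypothesis: a singleton block lies in whatever coarser
  block contains its point.\<close>

lemma cover_le_family:
  assumes X: "Hausdorff_space X" and V: "end_family X \<V>" and W: "end_family X \<W>"
    and ref: "\<And>W. W \<in> \<W> \<Longrightarrow> \<exists>V\<in>\<V>. W \<subseteq> V"
  shows "cover_le X (family_cover X \<V>) (family_cover X \<W>)"
proof -
  have pv: "partition_on (topspace X) (cover_partition X (family_cover X \<V>))"
    and pw: "partition_on (topspace X) (cover_partition X (family_cover X \<W>))"
    using assms by (auto intro: partition_on_cover_partition family_cover_in_end_covers)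
  have "\<exists>C\<in>cover_partition X (family_cover X \<V>). B \<subseteq> C"
    if B: "B \<in> cover_partition X (family_cover X \<W>)" for B
  proof -
    consider x where "B = {x}" "x \<in> topspace X" | W where "B = X closure_of W" "W \<in> \<W>"
      using B by (auto simp: cover_partition_def family_cover_def)
    then show ?thesis
    proof cases
      case 1
      then show ?thesis
        using block_of_in[OF pv, of x] by blast
    next
      case 2
      then obtain V where "V \<in> \<V>" "W \<subseteq> V" using ref by blast
      then show ?thesis
        using 2 by (intro bexI[of _ "X closure_of V"]) (auto simp: cover_partition_def closure_of_mono)
    qed
  qed
  then show ?thesis
    using pv pw by (simp add: cover_le_def refines_def)
qed

lemma cover_le_meet:
  assumes X: "Hausdorff_space X" and V: "end_family X \<V>" and W: "end_family X \<W>"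
  shows "cover_le X (family_cover X \<V>) (family_cover X (family_meet \<V> \<W>))"
    and "cover_le X (family_cover X \<W>) (family_cover X (family_meet \<V> \<W>))"
proof -
  have "\<exists>V\<in>\<V>. Z \<subseteq> V" "\<exists>W\<in>\<W>. Z \<subseteq> W" if "Z \<in> family_meet \<V> \<W>" for Z
    using that unfolding family_meet_def by blast+
  then show "cover_le X (family_cover X \<V>) (family_cover X (family_meet \<V> \<W>))"
    and "cover_le X (family_cover X \<W>) (family_cover X (family_meet \<V> \<W>))"
    using cover_le_family[OF X] V W end_family_meet[OF V W] by simp_all
qed

section \<open>Threads of the inverse limit\<close>

lemma topspace_freudenthal:
  "p \<in> topspace (freudenthal X) \<longleftrightarrow>
     p \<in> (\<Pi>\<^sub>E u\<in>end_covers X. cover_partition X u) \<and>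
     (\<forall>u\<in>end_covers X. \<forall>v\<in>end_covers X. cover_le X u v \<longrightarrow> coarsen (cover_partition X u) (p v) = p u)"
proof -
  have "(\<Pi>\<^sub>E u\<in>end_covers X. topspace (partition_space X (cover_partition X u))) =
        (\<Pi>\<^sub>E u\<in>end_covers X. cover_partition X u)"
    by (intro PiE_cong topspace_partition_space partition_on_cover_partition)
  then show ?thesis
    by (simp add: freudenthal_def inverse_limit_def)
qed

text \<open>Replaces the bonding map \<open>coarsen\<close>, a definite description, by plain
  inclusion of blocks.\<close>

lemma freudenthal_mono:
  assumes p: "p \<in> topspace (freudenthal X)" and u: "u \<in> end_covers X" and v: "v \<in> end_covers X"
    and le: "cover_le X u v"
  shows "p v \<subseteq> p u"
proof -
  have pp: "p v \<in> cover_partition X v" "coarsen (cover_partition X u) (p v) = p u"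
    using assms by (auto simp: topspace_freudenthal PiE_iff)
  then obtain C where "C \<in> cover_partition X u" "p v \<subseteq> C"
    using le by (auto simp: cover_le_def refines_def)
  moreover have "p v \<noteq> {}"
    using pp(1) partition_on_cover_partition[OF v] by (auto simp: partition_on_def)
  ultimately show ?thesis
    using coarsen_eq[OF partition_on_cover_partition[OF u]] pp(2) by metis
qed

lemma freudenthal_in:
  assumes p: "p \<in> topspace (freudenthal X)" and u: "u \<in> end_covers X"
  shows "p u \<in> cover_partition X u" "p u \<noteq> {}"
  using assms partition_on_cover_partition[OF u] by (auto simp: topspace_freudenthal PiE_iff partition_on_def)

text \<open>An end never takes a singleton as a coordinate: otherwise the common refinement with any
  other cover would force the same point into every coordinate, and the thread would be the image of
  that point.\<close>

lemma end_component:
  assumes X: "Hausdorff_space X" and e: "e \<in> ends X" and W: "end_family X \<W>"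
  obtains W where "W \<in> \<W>" "e (family_cover X \<W>) = X closure_of W"
proof -
  let ?u = "family_cover X \<W>"
  have ef: "e \<in> topspace (freudenthal X)" using e by (simp add: ends_def)
  have u: "?u \<in> end_covers X" by (rule family_cover_in_end_covers[OF X W])
  have "False" if x: "e ?u = {x}" "x \<in> topspace X" for x
  proof -
    have "e v = block_of (cover_partition X v) x" if v: "v \<in> end_covers X" for v
    proof -
      let ?z = "family_cover X (family_meet \<W> (snd v))"
      have fv: "end_family X (snd v)" "family_cover X (snd v) = v"
        using end_coversD[OF X v] by auto
      have z: "?z \<in> end_covers X"
        using family_cover_in_end_covers[OF X end_family_meet[OF W fv(1)]] .
      have "e ?z \<subseteq> e ?u" "e ?z \<subseteq> e v"
        using cover_le_meet[OF X W fv(1)] fv(2) freudenthal_mono[OF ef _ z] u v by simp_all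
      then have "x \<in> e v"
        using x freudenthal_in[OF ef z] by auto
      then show ?thesis
        using block_of_eq[OF partition_on_cover_partition[OF v] freudenthal_in(1)[OF ef v]] by simp
    qed
    then have "e = freudenthal_embed X x"
      using ef unfolding topspace_freudenthal freudenthal_embed_def
      by (intro extensionalityI[of _ "end_covers X"]) (simp_all add: PiE_iff)
    then show False
      using e x by (auto simp: ends_def)
  qed
  moreover have "e ?u \<in> cover_partition X ?u"
    using freudenthal_in[OF ef u] by simp
  ultimately show ?thesis
    using that by (auto simp: cover_partition_def family_cover_def)
qed

lemma end_family_eq:
  assumes "end_family X \<W>" "V \<in> \<W>" "W \<in> \<W>" "X closure_of V \<inter> X closure_of W \<noteq> {}"
  shows "V = W"
  using assms by (auto simp: end_family_def disjnt_def)

text \<open>At the common refinement the end chooses the closure of some nonempty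
  \<open>V' \<inter> W'\<close>. This closure lies in those of \<open>V\<close> and
  \<open>W\<close>, so disjointness of closures gives \<open>V' = V\<close> and
  \<open>W' = W\<close>.\<close>

lemma end_components_meet:
  assumes X: "Hausdorff_space X" and e: "e \<in> ends X"
    and V: "end_family X \<V>" "V \<in> \<V>" "e (family_cover X \<V>) = X closure_of V"
    and W: "end_family X \<W>" "W \<in> \<W>" "e (family_cover X \<W>) = X closure_of W"
  shows "V \<inter> W \<noteq> {}"
proof -
  let ?z = "family_cover X (family_meet \<V> \<W>)"
  have ef: "e \<in> topspace (freudenthal X)" using e by (simp add: ends_def)
  have fm: "end_family X (family_meet \<V> \<W>)" by (rule end_family_meet[OF V(1) W(1)])
  note cov = family_cover_in_end_covers[OF X]
  obtain Z where Z: "Z \<in> family_meet \<V> \<W>" "e ?z = X closure_of Z"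
    by (rule end_component[OF X e fm])
  then obtain V' W' where Z': "Z = V' \<inter> W'" "V' \<in> \<V>" "W' \<in> \<W>" "Z \<noteq> {}"
    by (auto simp: family_meet_def)
  have op: "openin X Z" using fm Z(1) by (auto simp: end_family_def)
  then have Zc: "Z \<subseteq> X closure_of Z" by (simp add: closure_of_subset openin_subset)
  have "X closure_of Z \<subseteq> X closure_of V" "X closure_of Z \<subseteq> X closure_of W"
    using freudenthal_mono[OF ef cov[OF V(1)] cov[OF fm] cover_le_meet(1)[OF X V(1) W(1)]]
      freudenthal_mono[OF ef cov[OF W(1)] cov[OF fm] cover_le_meet(2)[OF X V(1) W(1)]]
      V(3) W(3) Z(2) by simp_all
  moreover have "X closure_of Z \<subseteq> X closure_of V'" "X closure_of Z \<subseteq> X closure_of W'"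
    unfolding Z' by (simp_all add: closure_of_mono)
  ultimately have "Z \<subseteq> X closure_of V \<inter> X closure_of V'" "Z \<subseteq> X closure_of W \<inter> X closure_of W'"
    using Zc by blast+
  then have "V = V'" "W = W'"
    using Z' end_family_eq[OF V(1) V(2)] end_family_eq[OF W(1) W(2)] by blast+
  then show ?thesis
    using Z' by simp
qed

lemma openin_freudenthal_component:
  assumes "u \<in> end_covers X" "openin (partition_space X (cover_partition X u)) \<O>"
  shows "openin (freudenthal X) {p \<in> topspace (freudenthal X). p u \<in> \<O>}"
proof -
  have "continuous_map (freudenthal X) (partition_space X (cover_partition X u)) (\<lambda>p. p u)"
    unfolding freudenthal_def inverse_limit_def
    using continuous_map_product_projection[of u "end_covers X" "\<lambda>u. partition_space X (cover_partition X u)"] assms(1)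
    by (intro continuous_map_from_subtopology) simp
  then show ?thesis
    using openin_continuous_map_preimage[of _ _ "\<lambda>p. p u"] assms(2) by blast
qed

lemma openin_saturated_blocks:
  assumes u: "u \<in> end_covers X" and S: "openin X S"
    and sat: "\<And>B. B \<in> cover_partition X u \<Longrightarrow> B \<inter> S \<noteq> {} \<Longrightarrow> B \<subseteq> S"
  shows "openin (partition_space X (cover_partition X u)) {B \<in> cover_partition X u. B \<subseteq> S}"
proof -
  note P = partition_on_cover_partition[OF u]
  have "\<Union>{B \<in> cover_partition X u. B \<subseteq> S} = S"
  proof
    show "S \<subseteq> \<Union>{B \<in> cover_partition X u. B \<subseteq> S}"
    proof
      fix x assume x: "x \<in> S"
      then have "x \<in> topspace X" using S openin_subset by blast
      then show "x \<in> \<Union>{B \<in> cover_partition X u. B \<subseteq> S}"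
        using block_of_in[OF P] sat x by blast
    qed
  qed auto
  then show ?thesis
    using S by (simp add: openin_partition_space[OF P])
qed

section \<open>Spaces whose ends form a Cantor set\<close>

lemma openin_cylinder: "openin Cantor_space {k'. \<forall>i<n. k' i = k i}"
proof -
  have "{k'. \<forall>i<n. k' i = k i} = (\<Pi>\<^sub>E i\<in>UNIV. if i < n then {k i} else UNIV)"
    by (auto simp: PiE_iff split: if_splits)
  moreover have "openin Cantor_space \<dots>"
    unfolding Cantor_space_def
    by (rule openin_PiE_gen[THEN iffD2]) (auto intro: finite_subset[of _ "{..<n}"])
  ultimately show ?thesis by simp
qed

text \<open>\<open>D k n\<close> depends on the first \<open>n\<close> digits of \<open>k\<close> only. The sets \<open>D k n - Q k n\<close> shrink to one end
  for each \<open>k\<close>, although the cells \<open>D k n\<close> themselves need not shrink to anything.\<close>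

locale cantor_tails =
  fixes X :: "'a topology" and D Q :: "(nat \<Rightarrow> bool) \<Rightarrow> nat \<Rightarrow> 'a set"
  assumes Hausdorff: "Hausdorff_space X"
    and openin_D: "openin X (D k n)"
    and closure_D_Suc: "X closure_of D k (Suc n) \<subseteq> D k n"
    and D_cong: "(\<And>i. i < n \<Longrightarrow> k i = k' i) \<Longrightarrow> D k n = D k' n"
    and disjnt_closure_D: "i < n \<Longrightarrow> k i \<noteq> k' i \<Longrightarrow> disjnt (X closure_of D k n) (X closure_of D k' n)"
    and compactin_compl_D: "compactin X (topspace X - (\<Union>k. D k n))"
    and compactin_Q: "compactin X (Q k n)"
    and Q_Suc: "Q k n \<subseteq> X interior_of Q k (Suc n)"
    and connectedin_tail: "connectedin X (D k n - Q k n)"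
    and tail_nonempty: "D k n - Q k n \<noteq> {}"
    and Inter_tails: "(\<Inter>n. D k n - Q k n) = {}"
begin

section \<open>Covers by cells and by trimmed cells\<close>

definition tail :: "(nat \<Rightarrow> bool) \<Rightarrow> nat \<Rightarrow> 'a set" where
  "tail k n = D k n - Q k n"

definition cells :: "nat \<Rightarrow> 'a set set" where
  "cells n = range (\<lambda>k. D k n)"

text \<open>The cell of \<open>k\<close> is trimmed to its tail; as \<open>Q k n\<close> is compact,
  this is still an end family. Plain cells read off the digits of an end, trimmed ones close in on
  the single end of \<open>k\<close>.\<close>

definition tail_cells :: "(nat \<Rightarrow> bool) \<Rightarrow> nat \<Rightarrow> 'a set set" where
  "tail_cells k n = insert (tail k n) (cells n - {D k n})"

lemma openin_tail: "openin X (tail k n)"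
  unfolding tail_def
  using openin_D compactin_imp_closedin[OF Hausdorff compactin_Q] by (rule openin_diff)

lemma tail_subset_D: "tail k n \<subseteq> D k n"
  by (auto simp: tail_def)

lemma subset_closure: "openin X S \<Longrightarrow> S \<subseteq> X closure_of S"
  by (simp add: closure_of_subset openin_subset)

lemma D_nonempty: "D k n \<noteq> {}"
  using tail_nonempty by blast

text \<open>The interior of \<open>Q k (Suc n)\<close> is an open set missing the tail, so it misses
  the closure as well, and it contains \<open>Q k n\<close>.\<close>

lemma closure_tail_Suc: "X closure_of tail k (Suc n) \<subseteq> tail k n"
proof -
  have "tail k (Suc n) \<subseteq> topspace X - X interior_of Q k (Suc n)"
    using openin_subset[OF openin_D] interior_of_subset by (fastforce simp: tail_def)
  then have "X closure_of tail k (Suc n) \<subseteq> topspace X - X interior_of Q k (Suc n)"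
    by (intro closure_of_minimal) auto
  moreover have "X closure_of tail k (Suc n) \<subseteq> D k n"
    using closure_of_mono[OF tail_subset_D] closure_D_Suc by blast
  ultimately show ?thesis
    using Q_Suc by (fastforce simp: tail_def)
qed

lemma tail_antimono: "m \<le> n \<Longrightarrow> tail k n \<subseteq> tail k m"
  by (rule lift_Suc_antimono_le[of "tail k"])
    (use closure_tail_Suc subset_closure[OF openin_tail] in blast)+

lemma D_antimono: "m \<le> n \<Longrightarrow> D k n \<subseteq> D k m"
  by (rule lift_Suc_antimono_le[of "D k"])
    (use closure_D_Suc subset_closure[OF openin_D] in blast)+

lemma finite_cells: "finite (cells n)"
proof -
  \<comment> \<open>A cell of level \<open>n\<close> is named by a word of length \<open>n\<close>,
    padded with \<open>False\<close>; by \<open>D_cong\<close> the padding does not affect the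
    cell.\<close>
  define F where "F xs = D (\<lambda>i. i < n \<and> xs ! i) n" for xs
  have "cells n \<subseteq> F ` {xs. set xs \<subseteq> UNIV \<and> length xs = n}"
  proof (clarsimp simp: cells_def)
    fix k
    have "D k n = F (map k [0..<n])"
      unfolding F_def by (rule D_cong) simp
    then show "D k n \<in> F ` {xs. length xs = n}" by (intro image_eqI[of _ _ "map k [0..<n]"]) auto
  qed
  moreover have "finite {xs :: bool list. set xs \<subseteq> UNIV \<and> length xs = n}"
    by (rule finite_lists_length_eq) simp
  ultimately show ?thesis
    by (rule finite_surj[rotated])
qed

lemma cells_disjnt:
  assumes "U \<in> cells n" "V \<in> cells n" "U \<noteq> V"
  shows "disjnt (X closure_of U) (X closure_of V)"
proof -
  obtain k k' where k: "U = D k n" "V = D k' n"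
    using assms(1,2) by (auto simp: cells_def)
  then obtain i where "i < n" "k i \<noteq> k' i"
    using assms(3) D_cong[of n k k'] by blast
  then show ?thesis
    unfolding k by (rule disjnt_closure_D)
qed

lemma end_family_cells: "end_family X (cells n)"
proof -
  have "\<Union>(cells n) = (\<Union>k. D k n)" by (simp add: cells_def)
  moreover have "{} \<notin> cells n" using D_nonempty unfolding cells_def by (metis imageE)
  moreover have "\<forall>U\<in>cells n. openin X U" using openin_D by (simp add: cells_def)
  ultimately show ?thesis
    unfolding end_family_def using finite_cells cells_disjnt compactin_compl_D by simp
qed

lemma end_family_tail_cells: "end_family X (tail_cells k n)"
proof -
  have dis: "disjnt (X closure_of tail k n) (X closure_of U)" if "U \<in> cells n - {D k n}" for U
    using cells_disjnt[of "D k n" n U] that closure_of_mono[OF tail_subset_D, of X k n]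
    by (auto simp: cells_def disjnt_iff)
  have "\<And>U V. U \<in> tail_cells k n \<Longrightarrow> V \<in> tail_cells k n \<Longrightarrow> U \<noteq> V \<Longrightarrow> disjnt (X closure_of U) (X closure_of V)"
    using dis cells_disjnt unfolding tail_cells_def by (metis Diff_iff disjnt_sym insertE)
  moreover have op: "\<And>U. U \<in> tail_cells k n \<Longrightarrow> openin X U"
    using openin_tail openin_D by (auto simp: tail_cells_def cells_def)
  moreover have "compactin X (topspace X - \<Union>(tail_cells k n))"
  proof (rule closed_compactin)
    show "compactin X ((topspace X - (\<Union>k. D k n)) \<union> Q k n)"
      by (intro compactin_Un compactin_compl_D compactin_Q)
    show "topspace X - \<Union>(tail_cells k n) \<subseteq> (topspace X - (\<Union>k. D k n)) \<union> Q k n"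
      by (auto simp: tail_cells_def cells_def tail_def)
    show "closedin X (topspace X - \<Union>(tail_cells k n))"
      using op by (intro closedin_diff closedin_topspace openin_Union)
  qed
  moreover have "{} \<notin> tail_cells k n"
    using tail_nonempty[of k n] end_familyD(2)[OF end_family_cells] by (auto simp: tail_cells_def tail_def)
  ultimately show ?thesis
    unfolding end_family_def using finite_cells by (simp add: tail_cells_def)
qed

text \<open>The complements of the closures of the tails form an increasing open cover, because by
  \<open>closure_tail_Suc\<close> these closures also have empty intersection.\<close>

lemma compact_misses_tail:
  assumes C: "compactin X C"
  obtains n where "C \<inter> tail k n = {}"
proof -
  let ?U = "\<lambda>n. topspace X - X closure_of tail k n"
  have "\<exists>n. x \<in> ?U n" if "x \<in> C" for x
  proof -
    obtain n where "x \<notin> tail k n"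
      using Inter_tails[of k] by (auto simp: tail_def)
    then have "x \<notin> X closure_of tail k (Suc n)"
      using closure_tail_Suc by blast
    then show ?thesis
      using that compactin_subset_topspace[OF C] by blast
  qed
  then have "C \<subseteq> \<Union>(range ?U)" by blast
  moreover have "\<forall>U\<in>range ?U. openin X U" by auto
  ultimately obtain \<F> where F: "finite \<F>" "\<F> \<subseteq> range ?U" "C \<subseteq> \<Union>\<F>"
    using C unfolding compactin_def by meson
  then obtain N where N: "finite N" "\<F> = ?U ` N"
    by (meson finite_subset_image)
  then obtain m where m: "\<forall>n\<in>N. n \<le> m"
    by (meson finite_nat_set_iff_bounded_le)
  have "C \<inter> tail k m = {}"
  proof (rule ccontr)
    assume "C \<inter> tail k m \<noteq> {}"
    then obtain x n where "x \<in> tail k m" "n \<in> N" "x \<notin> X closure_of tail k n"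
      using F(3) N by blast
    then show False
      using m tail_antimono[of n m] subset_closure[OF openin_tail] by blast
  qed
  then show ?thesis by (rule that)
qed

text \<open>A late tail avoids the compact complement of the family, so the disjoint open members
  cover it; being connected, it lies in one of them.\<close>

lemma tail_in_component:
  assumes W: "end_family X \<W>"
  obtains n W where "W \<in> \<W>" "tail k n \<subseteq> W"
proof -
  note w = end_familyD[OF W]
  obtain n where n: "(topspace X - \<Union>\<W>) \<inter> tail k n = {}"
    using compact_misses_tail[OF w(5)] by blast
  then have sub: "tail k n \<subseteq> \<Union>\<W>"
    using openin_subset[OF openin_tail] by blast
  obtain x where x: "x \<in> tail k n" using tail_nonempty by (auto simp: tail_def)
  then obtain W where W': "W \<in> \<W>" "x \<in> W" using sub by blast
  have "W \<inter> V = {}" if "V \<in> \<W> - {W}" for V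
    using end_family_subset_closure(1)[OF W] w(4)[of W V] that W' unfolding disjnt_def by blast
  then have "W \<inter> \<Union>(\<W> - {W}) = {}" by blast
  moreover have "openin X (\<Union>(\<W> - {W}))" using w(3) by (intro openin_Union) blast
  moreover have "tail k n \<subseteq> W \<union> \<Union>(\<W> - {W})" using sub by blast
  moreover have "connectedin X (tail k n)" using connectedin_tail by (simp add: tail_def)
  ultimately have "\<Union>(\<W> - {W}) \<inter> tail k n = {}"
    using w(3)[OF W'(1)] x W'(2) unfolding connectedin by blast
  then have "tail k n \<subseteq> W" using sub by blast
  then show ?thesis using that W' by blast
qed

text \<open>The chosen member exists by \<open>tail_in_component\<close>; it is unique because tails
  are nested and nonempty.\<close>

definition tail_end :: "(nat \<Rightarrow> bool) \<Rightarrow> 'a end_cover \<Rightarrow> 'a set" where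
  "tail_end k = (\<lambda>u\<in>end_covers X. X closure_of (THE W. W \<in> snd u \<and> (\<exists>n. tail k n \<subseteq> W)))"

lemma tail_component_unique:
  assumes W: "end_family X \<W>" and "V \<in> \<W>" "tail k m \<subseteq> V" "W \<in> \<W>" "tail k n \<subseteq> W"
  shows "V = W"
proof (rule end_family_eq[OF W assms(2,4)])
  have "tail k (max m n) \<subseteq> V \<inter> W"
    using tail_antimono[of m "max m n" k] tail_antimono[of n "max m n" k] assms by auto
  moreover have "tail k (max m n) \<noteq> {}"
    using tail_nonempty by (simp add: tail_def)
  ultimately show "X closure_of V \<inter> X closure_of W \<noteq> {}"
    using end_family_subset_closure(1)[OF W] assms by blast
qed

lemma tail_end_eq:
  assumes W: "end_family X \<W>" and "W \<in> \<W>" "tail k n \<subseteq> W"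
  shows "tail_end k (family_cover X \<W>) = X closure_of W"
proof -
  have "(THE W. W \<in> \<W> \<and> (\<exists>n. tail k n \<subseteq> W)) = W"
    using assms tail_component_unique[OF W] by (intro the_equality) blast+
  then show ?thesis
    using family_cover_in_end_covers[OF Hausdorff W] by (simp add: tail_end_def)
qed

lemma tail_end_tail_cells: "tail_end k (family_cover X (tail_cells k n)) = X closure_of tail k n"
  by (rule tail_end_eq[OF end_family_tail_cells]) (auto simp: tail_cells_def)

lemma tail_end_cells: "tail_end k (family_cover X (cells n)) = X closure_of D k n"
  by (rule tail_end_eq[OF end_family_cells _ tail_subset_D]) (auto simp: cells_def)

lemma closure_component_in_partition:
  "W \<in> \<W> \<Longrightarrow> X closure_of W \<in> cover_partition X (family_cover X \<W>)"
  by (simp add: cover_partition_def)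

lemma tail_end_in_freudenthal: "tail_end k \<in> topspace (freudenthal X)"
  unfolding topspace_freudenthal PiE_iff
proof (intro conjI ballI impI)
  show "tail_end k \<in> extensional (end_covers X)" by (simp add: tail_end_def)
  show "tail_end k u \<in> cover_partition X u" if "u \<in> end_covers X" for u
  proof -
    note u = end_coversD[OF Hausdorff that]
    obtain n W where "W \<in> snd u" "tail k n \<subseteq> W"
      using tail_in_component[OF u(1)] .
    then show ?thesis
      using tail_end_eq[OF u(1)] closure_component_in_partition[of W "snd u"] u(2) by metis
  qed
  show "coarsen (cover_partition X u) (tail_end k v) = tail_end k u"
    if uv: "u \<in> end_covers X" "v \<in> end_covers X" "cover_le X u v" for u v
  proof -
    note u = end_coversD[OF Hausdorff uv(1)] and v = end_coversD[OF Hausdorff uv(2)]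
    obtain m U where U: "U \<in> snd u" "tail k m \<subseteq> U" using tail_in_component[OF u(1)] .
    obtain n V where V: "V \<in> snd v" "tail k n \<subseteq> V" using tail_in_component[OF v(1)] .
    have eU: "tail_end k u = X closure_of U" "X closure_of U \<in> cover_partition X u"
      using tail_end_eq[OF u(1) U] closure_component_in_partition[OF U(1)] u(2) by auto
    have eV: "tail_end k v = X closure_of V" "X closure_of V \<in> cover_partition X v"
      using tail_end_eq[OF v(1) V] closure_component_in_partition[OF V(1)] v(2) by auto
    note P = partition_on_cover_partition[OF uv(1)]
    obtain C where C: "C \<in> cover_partition X u" "X closure_of V \<subseteq> C"
      using uv(3) eV(2) by (auto simp: cover_le_def refines_def)
    \<comment> \<open>A point of a common tail lies in both closures, which identifies the block
      \<open>C\<close> containing the closure of \<open>V\<close> as the closure of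
      \<open>U\<close>.\<close>
    have "tail k (max m n) \<subseteq> U \<inter> V"
      using tail_antimono[of m "max m n" k] tail_antimono[of n "max m n" k] U V by auto
    moreover obtain x where "x \<in> tail k (max m n)"
      using tail_nonempty by (auto simp: tail_def)
    ultimately have "x \<in> X closure_of U" "x \<in> X closure_of V"
      using end_family_subset_closure(1)[OF u(1) U(1)] end_family_subset_closure(1)[OF v(1) V(1)] by blast+
    then have "C = X closure_of U" "X closure_of V \<noteq> {}"
      using block_of_eq[OF P C(1)] block_of_eq[OF P eU(2)] C(2) by blast+
    then show ?thesis
      using coarsen_eq[OF P C] eU eV by simp
  qed
qed

text \<open>A point of the space lies in its own coordinate at every cover, here in all tails at
  once, contrary to \<open>Inter_tails\<close>.\<close>

lemma embed_not_in_all_tails: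
  assumes "p \<in> topspace (freudenthal X)"
    and "\<And>n. p (family_cover X (tail_cells k (Suc n))) \<subseteq> tail k n"
  shows "p \<in> ends X"
proof -
  have False if x: "x \<in> topspace X" "p = freudenthal_embed X x" for x
  proof -
    have "x \<in> tail k n" for n
    proof -
      let ?u = "family_cover X (tail_cells k (Suc n))"
      have u: "?u \<in> end_covers X"
        by (rule family_cover_in_end_covers[OF Hausdorff end_family_tail_cells])
      then have "x \<in> p ?u"
        using x block_of_in(2)[OF partition_on_cover_partition[OF u]] by (simp add: freudenthal_embed_def)
      then show ?thesis
        using assms(2) by blast
    qed
    then show False
      using Inter_tails[of k] by (auto simp: tail_def)
  qed
  then show ?thesis
    using assms(1) by (auto simp: ends_def)
qed

lemma tail_end_in_ends: "tail_end k \<in> ends X"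
  by (rule embed_not_in_all_tails[where k = k, OF tail_end_in_freudenthal])
    (simp add: tail_end_tail_cells closure_tail_Suc)

text \<open>Infinitely many trimmed covers determine the end: in an arbitrary cover, the member
  chosen by \<open>e\<close> meets a tail lying inside the member chosen by
  \<open>tail_end k\<close>.\<close>

lemma end_eq_tail_end:
  assumes e: "e \<in> ends X" and br: "\<And>n. \<exists>m\<ge>n. e (family_cover X (tail_cells k m)) = X closure_of tail k m"
  shows "e = tail_end k"
proof -
  have "e v = tail_end k v" if "v \<in> end_covers X" for v
  proof -
    note v = end_coversD[OF Hausdorff that]
    obtain n V where V: "V \<in> snd v" "tail k n \<subseteq> V" using tail_in_component[OF v(1)] .
    obtain V' where V': "V' \<in> snd v" "e v = X closure_of V'"
      using end_component[OF Hausdorff e v(1)] v(2) by metis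
    obtain m where m: "m \<ge> n" "e (family_cover X (tail_cells k m)) = X closure_of tail k m"
      using br by blast
    have "tail k m \<inter> V' \<noteq> {}"
      by (rule end_components_meet[OF Hausdorff e end_family_tail_cells _ m(2) v(1) V'(1)])
        (use v(2) V'(2) in \<open>auto simp: tail_cells_def\<close>)
    then have "V \<inter> V' \<noteq> {}"
      using V(2) tail_antimono[OF m(1)] by blast
    then have "V = V'"
      using end_family_eq[OF v(1) V(1) V'(1)] end_family_subset_closure(1)[OF v(1)] V(1) V'(1) by blast
    then show ?thesis
      using tail_end_eq[OF v(1) V] V'(2) v(2) by simp
  qed
  moreover have "e \<in> extensional (end_covers X)"
    using e by (simp add: ends_def topspace_freudenthal PiE_iff)
  ultimately show ?thesis
    by (intro extensionalityI[of _ "end_covers X"]) (auto simp: tail_end_def)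
qed

section \<open>Ends correspond to digit sequences\<close>

lemma D_eq_imp_agree:
  assumes "D k n \<inter> D k' n \<noteq> {}" "i < n"
  shows "k i = k' i"
  using assms disjnt_closure_D[of i n k k'] subset_closure[OF openin_D]
  unfolding disjnt_def by blast

text \<open>The cells chosen at different levels meet, so their digits are coherent and define one
  sequence \<open>k\<close>. In the trimmed cover only \<open>tail k n\<close> meets the chosen cell
  \<open>D k n\<close>.\<close>

lemma ends_eq: "ends X = range tail_end"
proof (intro set_eqI iffI)
  fix e assume e: "e \<in> ends X"
  have "\<exists>k. e (family_cover X (cells n)) = X closure_of D k n" for n
  proof -
    obtain W where "W \<in> cells n" "e (family_cover X (cells n)) = X closure_of W"
      using end_component[OF Hausdorff e end_family_cells] .
    then show ?thesis by (auto simp: cells_def)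
  qed
  then obtain b where b: "\<And>n. e (family_cover X (cells n)) = X closure_of D (b n) n" by metis
  \<comment> \<open>Level \<open>Suc i\<close> is the first one whose cells depend on digit
    \<open>i\<close>.\<close>
  define k where "k i = b (Suc i) i" for i
  have bb: "b m i = b n i" if "i < m" "i < n" for m n i
  proof -
    have "D (b m) m \<inter> D (b n) n \<noteq> {}"
      by (rule end_components_meet[OF Hausdorff e end_family_cells _ b end_family_cells _ b])
        (auto simp: cells_def)
    then have "D (b m) (Suc i) \<inter> D (b n) (Suc i) \<noteq> {}"
      using D_antimono[OF Suc_leI[OF that(1)], of "b m"] D_antimono[OF Suc_leI[OF that(2)], of "b n"] by blast
    then show ?thesis by (rule D_eq_imp_agree) simp
  qed
  have Dk: "D (b n) n = D k n" for n
  proof (rule D_cong)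
    show "b n i = k i" if "i < n" for i
      unfolding k_def by (rule bb[OF that lessI])
  qed
  have "e (family_cover X (tail_cells k n)) = X closure_of tail k n" for n
  proof -
    obtain W where W: "W \<in> tail_cells k n" "e (family_cover X (tail_cells k n)) = X closure_of W"
      using end_component[OF Hausdorff e end_family_tail_cells] .
    have meet: "W \<inter> D k n \<noteq> {}"
      by (rule end_components_meet[OF Hausdorff e end_family_tail_cells W end_family_cells])
        (simp_all add: cells_def b[unfolded cells_def] Dk)
    have "W = tail k n"
    proof (rule ccontr)
      assume "W \<noteq> tail k n"
      then have "W \<in> cells n" "W \<noteq> D k n" using W(1) by (auto simp: tail_cells_def)
      moreover have Dk: "D k n \<in> cells n" by (simp add: cells_def)
      ultimately have "disjnt (X closure_of W) (X closure_of D k n)"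
        using cells_disjnt by blast
      then show False
        using meet end_family_subset_closure(1)[OF end_family_cells] \<open>W \<in> cells n\<close> Dk
        unfolding disjnt_def by blast
    qed
    then show ?thesis using W by simp
  qed
  then have "\<exists>m\<ge>n. e (family_cover X (tail_cells k m)) = X closure_of tail k m" for n
    by (intro exI[of _ n]) simp
  then have "e = tail_end k"
    by (rule end_eq_tail_end[OF e, of k])
  then show "e \<in> range tail_end" by simp
qed (auto simp: tail_end_in_ends)

lemma inj_tail_end: "inj tail_end"
proof (rule injI)
  fix k k' assume eq: "tail_end k = tail_end k'"
  show "k = k'"
  proof
    fix i
    have "X closure_of D k (Suc i) = X closure_of D k' (Suc i)"
      using tail_end_cells eq by metis
    moreover have "X closure_of D k (Suc i) \<noteq> {}"
      using subset_closure[OF openin_D] D_nonempty by blast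
    ultimately show "k i = k' i"
      using disjnt_closure_D[of i "Suc i" k k'] by (auto simp: disjnt_def)
  qed
qed

text \<open>The tail itself need not be saturated for the next cover, since \<open>Q k n\<close> may cut through other
  cells of level \<open>n + 1\<close>; their closures are therefore removed from it.\<close>

lemma short_end_tail_end: "short_end X (tail_end k)"
proof -
  define S where "S n = tail k n - (\<Union>U\<in>cells (Suc n) - {D k (Suc n)}. X closure_of U)" for n
  \<comment> \<open>One level finer than \<open>S n\<close>, so that the block of the end, the
    closure of \<open>tail k (Suc n)\<close>, fits into \<open>S n\<close>.\<close>
  define u where "u n = family_cover X (tail_cells k (Suc n))" for n
  define \<O> where "\<O> n = {B \<in> cover_partition X (u n). B \<subseteq> S n}" for n
  define G where "G n = {p \<in> topspace (freudenthal X). p (u n) \<in> \<O> n}" for n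
  have u: "u n \<in> end_covers X" for n
    unfolding u_def by (rule family_cover_in_end_covers[OF Hausdorff end_family_tail_cells])
  have tS: "X closure_of tail k (Suc n) \<subseteq> S n" for n
  proof -
    have "disjnt (X closure_of tail k (Suc n)) (X closure_of U)" if "U \<in> cells (Suc n) - {D k (Suc n)}" for U
      using cells_disjnt[of "D k (Suc n)" "Suc n" U] that closure_of_mono[OF tail_subset_D, of X k "Suc n"]
      by (auto simp: cells_def disjnt_iff)
    then show ?thesis
      using closure_tail_Suc[of k n] by (auto simp: S_def disjnt_iff)
  qed
  have "openin (freudenthal X) (G n)" for n
    unfolding G_def
  proof (rule openin_freudenthal_component[OF u])
    show "openin (partition_space X (cover_partition X (u n))) (\<O> n)"
      unfolding \<O>_def
    proof (rule openin_saturated_blocks[OF u])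
      show "openin X (S n)"
        unfolding S_def using finite_cells
        by (intro openin_diff openin_tail closedin_Union) auto
      fix B assume B: "B \<in> cover_partition X (u n)" "B \<inter> S n \<noteq> {}"
      then consider x where "B = {x}" | "B = X closure_of tail k (Suc n)"
        | U where "U \<in> cells (Suc n) - {D k (Suc n)}" "B = X closure_of U"
        by (auto simp: cover_partition_def u_def tail_cells_def)
      then show "B \<subseteq> S n"
        by cases (use B(2) tS in \<open>auto simp: S_def\<close>)
    qed
  qed
  moreover have "(\<Inter>n. G n) = {tail_end k}"
  proof
    have "tail_end k (u n) = X closure_of tail k (Suc n)"
      "X closure_of tail k (Suc n) \<in> cover_partition X (u n)" for n
      unfolding u_def by (rule tail_end_tail_cells, rule closure_component_in_partition) (simp add: tail_cells_def)
    then show "{tail_end k} \<subseteq> (\<Inter>n. G n)"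
      using tS tail_end_in_freudenthal by (simp add: G_def \<O>_def)
    show "(\<Inter>n. G n) \<subseteq> {tail_end k}"
    proof
      fix p assume p: "p \<in> (\<Inter>n. G n)"
      then have pS: "p (u n) \<subseteq> S n" for n by (auto simp: G_def \<O>_def)
      have e: "p \<in> ends X"
      proof (rule embed_not_in_all_tails)
        show "p \<in> topspace (freudenthal X)" using p by (auto simp: G_def)
        show "p (family_cover X (tail_cells k (Suc n))) \<subseteq> tail k n" for n
          using pS[of n] by (auto simp: u_def S_def)
      qed
      have "p (family_cover X (tail_cells k (Suc n))) = X closure_of tail k (Suc n)" for n
      proof -
        obtain W where W: "W \<in> tail_cells k (Suc n)"
          "p (family_cover X (tail_cells k (Suc n))) = X closure_of W"
          using end_component[OF Hausdorff e end_family_tail_cells] .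
        then have "X closure_of W \<subseteq> S n" using pS[of n] by (simp add: u_def)
        moreover have "X closure_of W \<noteq> {}"
          using end_family_subset_closure[OF end_family_tail_cells W(1)] by blast
        ultimately have "W \<notin> cells (Suc n) - {D k (Suc n)}"
          by (auto simp: S_def)
        then show ?thesis using W by (auto simp: tail_cells_def)
      qed
      then have "p = tail_end k"
        by (intro end_eq_tail_end[OF e]) (meson le_Suc_eq order_refl)
      then show "p \<in> {tail_end k}" by simp
    qed
  qed
  ultimately have "gdelta_in (freudenthal X) {tail_end k}"
    using gdelta_in_Inter[of "range G" "freudenthal X"] open_imp_gdelta_in by force
  then show ?thesis
    by (simp add: short_end_def tail_end_in_ends)
qed

lemma short_ends: "e \<in> ends X \<Longrightarrow> short_end X e"
  using short_end_tail_end by (auto simp: ends_eq)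

text \<open>Each coordinate is locally constant. Let \<open>tail k n\<close> lie in \<open>V\<close>
  and let \<open>k'\<close> share the first \<open>n\<close> digits. Although \<open>Q k' n\<close>
  may differ from \<open>Q k n\<close>, a late tail of \<open>k'\<close> lies in
  \<open>D k n\<close> and avoids the compact set \<open>Q k n\<close>, so it lies in
  \<open>tail k n\<close> and in \<open>V\<close>.\<close>

lemma continuous_map_tail_end: "continuous_map Cantor_space (end_space X) tail_end"
proof -
  have loc: "continuous_map Cantor_space (partition_space X (cover_partition X v)) (\<lambda>k. tail_end k v)"
    if "v \<in> end_covers X" for v
  proof -
    note v = end_coversD[OF Hausdorff that]
    have P: "tail_end k v \<in> cover_partition X v" for k
      using tail_end_in_freudenthal[of k] that by (auto simp: topspace_freudenthal PiE_iff)
    have "\<exists>n. \<forall>k'. (\<forall>i<n. k' i = k i) \<longrightarrow> tail_end k' v = tail_end k v" for k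
    proof -
      obtain n V where V: "V \<in> snd v" "tail k n \<subseteq> V" using tail_in_component[OF v(1)] .
      have "tail_end k' v = tail_end k v" if k': "\<forall>i<n. k' i = k i" for k'
      proof -
        obtain m where m: "Q k n \<inter> tail k' m = {}"
          using compact_misses_tail[OF compactin_Q] .
        have "tail k' (max m n) \<subseteq> D k' n"
          using tail_antimono[of n "max m n" k'] tail_subset_D by fastforce
        moreover have "D k' n = D k n" using D_cong k' by metis
        moreover have "Q k n \<inter> tail k' (max m n) = {}"
          using m tail_antimono[of m "max m n" k'] by auto
        ultimately have "tail k' (max m n) \<subseteq> V"
          using V(2) by (auto simp: tail_def)
        then show ?thesis
          using tail_end_eq[OF v(1) V] tail_end_eq[OF v(1) V(1)] v(2) by metis
      qed
      then show ?thesis by blast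
    qed
    then obtain N where N: "\<And>k k'. \<forall>i<N k. k' i = k i \<Longrightarrow> tail_end k' v = tail_end k v"
      by metis
    have "openin Cantor_space {k. tail_end k v \<in> \<O>}" for \<O>
    proof (subst openin_subopen, intro ballI)
      fix k assume "k \<in> {k. tail_end k v \<in> \<O>}"
      then have "{k'. \<forall>i<N k. k' i = k i} \<subseteq> {k. tail_end k v \<in> \<O>}"
        using N by auto
      then show "\<exists>T. openin Cantor_space T \<and> k \<in> T \<and> T \<subseteq> {k. tail_end k v \<in> \<O>}"
        using openin_cylinder by blast
    qed
    then show ?thesis
      using P topspace_partition_space[OF partition_on_cover_partition[OF that]]
      by (simp add: continuous_map_def Cantor_space_def)
  qed
  have "tail_end k \<in> extensional (end_covers X)" for k
    by (simp add: tail_end_def)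
  then have "continuous_map Cantor_space (product_topology (\<lambda>u. partition_space X (cover_partition X u)) (end_covers X)) tail_end"
    using loc by (auto simp only: continuous_map_componentwise)
  moreover have "tail_end k \<in> topspace (freudenthal X)" for k
    by (rule tail_end_in_freudenthal)
  ultimately have "continuous_map Cantor_space (freudenthal X) tail_end"
    unfolding freudenthal_def inverse_limit_def
    by (auto simp: continuous_map_in_subtopology)
  then show ?thesis
    unfolding end_space_def by (auto simp: continuous_map_in_subtopology ends_eq)
qed

lemma Hausdorff_end_space: "Hausdorff_space (end_space X)"
  unfolding Hausdorff_space_def
proof (intro allI impI)
  fix e e' assume ee: "e \<in> topspace (end_space X) \<and> e' \<in> topspace (end_space X) \<and> e \<noteq> e'"
  then obtain k k' where k: "e = tail_end k" "e' = tail_end k'"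
    by (auto simp: end_space_def ends_eq)
  then have "k \<noteq> k'" using ee by blast
  then obtain i where i: "k i \<noteq> k' i" by blast
  \<comment> \<open>Cells of level \<open>Suc i\<close> separate the two sequences; in the cover one
    level further down, every block that meets such a cell lies in it.\<close>
  define u where "u = family_cover X (cells (Suc (Suc i)))"
  have u: "u \<in> end_covers X"
    unfolding u_def by (rule family_cover_in_end_covers[OF Hausdorff end_family_cells])
  define G where "G k = {e \<in> topspace (end_space X). e u \<in> {B \<in> cover_partition X u. B \<subseteq> D k (Suc i)}}" for k
  have op: "openin (end_space X) (G k)" for k
  proof -
    have "openin (partition_space X (cover_partition X u)) {B \<in> cover_partition X u. B \<subseteq> D k (Suc i)}"
    proof (rule openin_saturated_blocks[OF u openin_D])
      fix B assume B: "B \<in> cover_partition X u" "B \<inter> D k (Suc i) \<noteq> {}"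
      then consider x where "B = {x}" | h where "B = X closure_of D h (Suc (Suc i))"
        by (auto simp: cover_partition_def u_def cells_def)
      then show "B \<subseteq> D k (Suc i)"
      proof cases
        case 2
        then have "B \<subseteq> D h (Suc i)" using closure_D_Suc by simp
        moreover from this have "D h (Suc i) = D k (Suc i)"
          using B(2) by (intro D_cong D_eq_imp_agree[of h "Suc i" k]) blast+
        ultimately show ?thesis by simp
      qed (use B(2) in auto)
    qed
    then have "openin (freudenthal X) {p \<in> topspace (freudenthal X). p u \<in> {B \<in> cover_partition X u. B \<subseteq> D k (Suc i)}}"
      by (rule openin_freudenthal_component[OF u])
    moreover have "G k = {p \<in> topspace (freudenthal X). p u \<in> {B \<in> cover_partition X u. B \<subseteq> D k (Suc i)}} \<inter> ends X"
      by (auto simp: G_def end_space_def)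
    ultimately show ?thesis
      unfolding end_space_def by (auto simp: openin_subtopology)
  qed
  moreover have mem: "tail_end k \<in> G k" for k
  proof -
    have "tail_end k u = X closure_of D k (Suc (Suc i))"
      "X closure_of D k (Suc (Suc i)) \<in> cover_partition X u"
      unfolding u_def by (rule tail_end_cells, rule closure_component_in_partition) (simp add: cells_def)
    then show ?thesis
      using tail_end_in_ends tail_end_in_freudenthal closure_D_Suc by (simp add: G_def end_space_def)
  qed
  moreover have "disjnt (G k) (G k')"
  proof -
    have "disjnt (D k (Suc i)) (D k' (Suc i))"
      using D_eq_imp_agree[of k "Suc i" k' i] i by (auto simp: disjnt_def)
    moreover have "B \<noteq> {}" if "B \<in> cover_partition X u" for B
      using partition_on_cover_partition[OF u] that by (auto simp: partition_on_def)
    ultimately show ?thesis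
      unfolding G_def disjnt_def by blast
  qed
  ultimately show "\<exists>U V. openin (end_space X) U \<and> openin (end_space X) V \<and> e \<in> U \<and> e' \<in> V \<and> disjnt U V"
    using k by blast
qed

lemma end_space_homeomorphic_Cantor: "end_space X homeomorphic_space Cantor_space"
proof -
  have "homeomorphic_map Cantor_space (end_space X) tail_end"
  proof (rule continuous_imp_homeomorphic_map[OF continuous_map_tail_end _ Hausdorff_end_space])
    show "compact_space Cantor_space"
      by (auto simp: Cantor_space_def compact_space_product_topology compact_space_discrete_topology)
    show "tail_end ` topspace Cantor_space = topspace (end_space X)"
      using tail_end_in_freudenthal by (auto simp: Cantor_space_def end_space_def ends_eq)
    show "inj_on tail_end (topspace Cantor_space)"
      using inj_tail_end by (auto intro: inj_on_subset)
  qed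
  then show ?thesis
    by (meson homeomorphic_map_imp_homeomorphic_space homeomorphic_space_sym)
qed

end

section \<open>Surfaces from atlases\<close>

lemma complex_homeomorphic_Euclidean_space:
  "(euclidean :: complex topology) homeomorphic_space Euclidean_space 2"
proof -
  define f :: "complex \<Rightarrow> nat \<Rightarrow> real"
    where "f z = (\<lambda>i. if i < 2 then if i = 0 then Re z else Im z else 0)" for z
  define g :: "(nat \<Rightarrow> real) \<Rightarrow> complex" where "g x = Complex (x 0) (x 1)" for x
  have "continuous_map euclidean (Euclidean_space 2) f"
    unfolding f_def
    by (subst continuous_map_componentwise_Euclidean_space) (auto intro!: continuous_intros)
  moreover have "continuous_map (Euclidean_space 2) euclidean g"
  proof -
    have c: "continuous_map (Euclidean_space 2) euclideanreal (\<lambda>x. x i)" for i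
      unfolding Euclidean_space_def
      using continuous_map_product_projection[of i UNIV "\<lambda>_. euclideanreal"]
      by (intro continuous_map_from_subtopology) simp
    have "continuous_map (Euclidean_space 2) euclidean (\<lambda>x. complex_of_real (x 0) + \<i> * complex_of_real (x 1))"
      by (intro continuous_map_add continuous_map_compose[OF c, of euclidean, unfolded o_def]
          continuous_map_compose[OF c, of euclidean "\<lambda>t. \<i> * complex_of_real t" 1, unfolded o_def])
        (auto intro!: continuous_intros)
    moreover have "g = (\<lambda>x. complex_of_real (x 0) + \<i> * complex_of_real (x 1))"
      by (simp add: g_def fun_eq_iff Complex_eq)
    ultimately show ?thesis by simp
  qed
  moreover have "g (f z) = z" for z
    by (simp add: f_def g_def)
  moreover have "f (g x) = x" if "x \<in> topspace (Euclidean_space 2)" for x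
    using that by (auto simp: f_def g_def topspace_Euclidean_space fun_eq_iff not_less less_2_cases_iff)
  ultimately have "homeomorphic_maps euclidean (Euclidean_space 2) f g"
    by (auto simp: homeomorphic_maps_def)
  then show ?thesis
    by (auto simp: homeomorphic_space_def)
qed

text \<open>\<open>transition\<close> says at once that overlaps are open (take
  \<open>G = dom j\<close>) and that coordinate changes are continuous. It is exactly what makes
  chart images open in the final topology \<open>glued\<close>.\<close>

locale atlas =
  fixes dom :: "'i \<Rightarrow> complex set" and chart :: "'i \<Rightarrow> complex \<Rightarrow> 'a"
  assumes open_dom: "open (dom i)"
    and inj_chart: "inj_on (chart i) (dom i)"
    and transition: "open G \<Longrightarrow> G \<subseteq> dom j \<Longrightarrow> open {z \<in> dom i. chart i z \<in> chart j ` G}"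
begin

definition glued :: "'a topology" where
  "glued = topology (\<lambda>W. W \<subseteq> (\<Union>i. chart i ` dom i) \<and> (\<forall>i. open {z \<in> dom i. chart i z \<in> W}))"

lemma openin_glued:
  "openin glued W \<longleftrightarrow> W \<subseteq> (\<Union>i. chart i ` dom i) \<and> (\<forall>i. open {z \<in> dom i. chart i z \<in> W})"
proof -
  have "istopology (\<lambda>W. W \<subseteq> (\<Union>i. chart i ` dom i) \<and> (\<forall>i. open {z \<in> dom i. chart i z \<in> W}))"
    unfolding istopology_def
  proof (intro conjI allI impI)
    fix S T i
    assume S: "S \<subseteq> (\<Union>i. chart i ` dom i) \<and> (\<forall>i. open {z \<in> dom i. chart i z \<in> S})"
      and T: "T \<subseteq> (\<Union>i. chart i ` dom i) \<and> (\<forall>i. open {z \<in> dom i. chart i z \<in> T})"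
    show "S \<inter> T \<subseteq> (\<Union>i. chart i ` dom i)" using S by blast
    have "{z \<in> dom i. chart i z \<in> S \<inter> T} = {z \<in> dom i. chart i z \<in> S} \<inter> {z \<in> dom i. chart i z \<in> T}"
      by auto
    then show "open {z \<in> dom i. chart i z \<in> S \<inter> T}"
      using S T by (simp add: open_Int)
  next
    fix \<K> i
    assume K: "\<forall>K\<in>\<K>. K \<subseteq> (\<Union>i. chart i ` dom i) \<and> (\<forall>i. open {z \<in> dom i. chart i z \<in> K})"
    then show "\<Union>\<K> \<subseteq> (\<Union>i. chart i ` dom i)" by blast
    have "{z \<in> dom i. chart i z \<in> \<Union>\<K>} = (\<Union>K\<in>\<K>. {z \<in> dom i. chart i z \<in> K})"
      by auto
    then show "open {z \<in> dom i. chart i z \<in> \<Union>\<K>}"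
      using K by auto
  qed
  then show ?thesis
    by (simp add: glued_def topology_inverse')
qed

lemma openin_chart_image: "open G \<Longrightarrow> G \<subseteq> dom i \<Longrightarrow> openin glued (chart i ` G)"
  using transition by (auto simp: openin_glued)

lemma topspace_glued: "topspace glued = (\<Union>i. chart i ` dom i)"
proof
  show "topspace glued \<subseteq> (\<Union>i. chart i ` dom i)"
    using openin_topspace[of glued] unfolding openin_glued by blast
  have "openin glued (chart i ` dom i)" for i
    using openin_chart_image[OF open_dom] by simp
  then show "(\<Union>i. chart i ` dom i) \<subseteq> topspace glued"
    using openin_subset by blast
qed

lemma continuous_map_chart: "continuous_map (top_of_set (dom i)) glued (chart i)"
  unfolding continuous_map_def
proof (intro conjI allI impI)
  show "chart i \<in> topspace (top_of_set (dom i)) \<rightarrow> topspace glued"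
    by (auto simp: topspace_glued)
  fix W assume "openin glued W"
  then have "open {z \<in> dom i. chart i z \<in> W}"
    by (simp add: openin_glued)
  then show "openin (top_of_set (dom i)) {z \<in> topspace (top_of_set (dom i)). chart i z \<in> W}"
    using open_dom by (simp add: openin_open_eq)
qed

lemma continuous_map_chart_subset: "S \<subseteq> dom i \<Longrightarrow> continuous_map (top_of_set S) glued (chart i)"
  using continuous_map_chart continuous_map_from_subtopology_mono by blast

lemma connectedin_chart_image: "connected S \<Longrightarrow> S \<subseteq> dom i \<Longrightarrow> connectedin glued (chart i ` S)"
  using connectedin_continuous_map_image[OF continuous_map_chart[of i], of S]
  by (simp add: connectedin_subtopology)

lemma compactin_chart_image: "compact S \<Longrightarrow> S \<subseteq> dom i \<Longrightarrow> compactin glued (chart i ` S)"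
  using image_compactin[OF _ continuous_map_chart[of i], of S]
  by (simp add: compactin_subtopology)

lemma chart_image_homeomorphic:
  assumes "open G" "G \<subseteq> dom i"
  shows "top_of_set G homeomorphic_space subtopology glued (chart i ` G)"
proof -
  have "homeomorphic_map (top_of_set G) (subtopology glued (chart i ` G)) (chart i)"
  proof (rule bijective_open_imp_homeomorphic_map)
    show "continuous_map (top_of_set G) (subtopology glued (chart i ` G)) (chart i)"
      using continuous_map_chart_subset[OF assms(2)] by (auto simp: continuous_map_in_subtopology)
    show "open_map (top_of_set G) (subtopology glued (chart i ` G)) (chart i)"
      unfolding open_map_def
    proof (intro allI impI)
      fix U assume "openin (top_of_set G) U"
      then have "open U" "U \<subseteq> G"
        using assms(1) by (auto simp: openin_open_eq)
      then have "openin glued (chart i ` U)" "chart i ` U \<subseteq> chart i ` G"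
        using assms(2) openin_chart_image by auto
      then show "openin (subtopology glued (chart i ` G)) (chart i ` U)"
        using openin_chart_image[OF assms] by (simp add: openin_open_subtopology)
    qed
    show "chart i ` topspace (top_of_set G) = topspace (subtopology glued (chart i ` G))"
      using openin_subset[OF openin_chart_image[OF assms]] by auto
    show "inj_on (chart i) (topspace (top_of_set G))"
      using inj_on_subset[OF inj_chart assms(2)] by simp
  qed
  then show ?thesis
    by (rule homeomorphic_map_imp_homeomorphic_space)
qed

lemma glued_locally_Euclidean:
  assumes "x \<in> topspace glued"
  shows "\<exists>U. openin glued U \<and> x \<in> U \<and> subtopology glued U homeomorphic_space Euclidean_space 2"
proof -
  obtain i z where z: "z \<in> dom i" "x = chart i z"
    using assms by (auto simp: topspace_glued)
  then obtain r where r: "r > 0" "ball z r \<subseteq> dom i"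
    using open_dom openE by blast
  obtain f g where "homeomorphism (ball z r) (UNIV :: complex set) f g"
    using homeomorphic_ball_UNIV[OF r(1), of z] by (auto simp: homeomorphic_def)
  then have "homeomorphic_maps (top_of_set (ball z r)) euclidean f g"
    by (auto simp: homeomorphism_def homeomorphic_maps_def continuous_map_in_subtopology)
  then have "top_of_set (ball z r) homeomorphic_space Euclidean_space 2"
    using complex_homeomorphic_Euclidean_space homeomorphic_space_trans homeomorphic_space_def by metis
  then have "subtopology glued (chart i ` ball z r) homeomorphic_space Euclidean_space 2"
    using chart_image_homeomorphic[OF open_ball r(2)] homeomorphic_space_sym homeomorphic_space_trans by metis
  then show ?thesis
    using openin_chart_image[OF open_ball r(2)] z r(1) by (intro exI[of _ "chart i ` ball z r"]) auto
qed

end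

section \<open>A Cantor set on the real line\<close>

text \<open>Base 4 with digits 1 and -1: the remainder after \<open>n\<close> digits is at most
  \<open>(4/3) / 4 ^ n\<close>, small against the separation \<open>8 / 4 ^ n\<close> of partial
  sums, and the signs keep the Cantor set away from 0.\<close>

definition cpart :: "(nat \<Rightarrow> bool) \<Rightarrow> nat \<Rightarrow> real" where
  "cpart k n = (\<Sum>i<n. (if k i then 1 else -1) / 4 ^ i)"

definition cpoint :: "(nat \<Rightarrow> bool) \<Rightarrow> real" where
  "cpoint k = (\<Sum>i. (if k i then 1 else -1) / 4 ^ i)"

lemma cpart_cong: "(\<And>i. i < n \<Longrightarrow> k i = k' i) \<Longrightarrow> cpart k n = cpart k' n"
  unfolding cpart_def by (rule sum.cong) auto

lemma cpart_Suc: "cpart k (Suc n) = cpart k n + (if k n then 1 else -1) / 4 ^ n"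
  by (simp add: cpart_def)

lemma cpoint_cpart: "\<bar>cpoint k - cpart k n\<bar> \<le> (4/3) / 4 ^ n"
proof -
  let ?a = "\<lambda>i. (if k i then 1 else -1) / 4 ^ i :: real"
  have ab: "norm (?a i) \<le> (1/4) ^ i" for i
    by (simp add: power_one_over divide_simps)
  have sm: "summable (\<lambda>i. (1/4) ^ i :: real)" by (rule summable_geometric) simp
  then have sa: "summable ?a"
    by (rule summable_comparison_test'[of _ 0]) (rule ab)
  have "cpoint k - cpart k n = (\<Sum>i. ?a (i + n))"
    unfolding cpoint_def cpart_def using suminf_minus_initial_segment[OF sa, of n] by simp
  moreover have "norm (\<Sum>i. ?a (i + n)) \<le> (\<Sum>i. (1/4) ^ (i + n))"
    by (rule norm_suminf_le) (use ab summable_ignore_initial_segment[OF sm] in auto)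
  moreover have "(\<Sum>i. (1/4) ^ (i + n)) = (4/3) / (4::real) ^ n"
  proof -
    have "(\<Sum>i. (1/4) ^ (i + n)) = (\<Sum>i. (1/4) ^ i) * (1/4 :: real) ^ n"
      unfolding power_add by (rule suminf_mult2[OF sm, symmetric])
    moreover have "(\<Sum>i. (1/4) ^ i) = (4/3 :: real)"
      by (subst suminf_geometric) simp_all
    ultimately show ?thesis
      by (simp only: power_one_over)
  qed
  ultimately show ?thesis by simp
qed

text \<open>The bound is attained when the sequences first differ at the last digit, where the gap
  is \<open>2 / 4 ^ n = 8 / 4 ^ Suc n\<close>. An earlier difference leaves at least
  \<open>8 - 2 = 6\<close> units of \<open>1 / 4 ^ n\<close>.\<close>

lemma cpart_separated: "\<exists>i<n. k i \<noteq> k' i \<Longrightarrow> \<bar>cpart k n - cpart k' n\<bar> \<ge> 8 / 4 ^ n"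
proof (induction n)
  case (Suc n)
  define s :: "(nat \<Rightarrow> bool) \<Rightarrow> real" where "s k = (if k n then 1 else -1) / 4 ^ n" for k
  have s: "\<bar>s k\<bar> \<le> 1 / 4 ^ n" for k by (simp add: s_def)
  have e: "cpart k (Suc n) - cpart k' (Suc n) = (cpart k n - cpart k' n) + (s k - s k')"
    by (simp add: cpart_Suc s_def)
  show ?case
  proof (cases "\<exists>j<n. k j \<noteq> k' j")
    case True
    then have "\<bar>cpart k n - cpart k' n\<bar> \<ge> 8 * (1 / 4 ^ n)"
      using Suc.IH by simp
    then have "\<bar>cpart k (Suc n) - cpart k' (Suc n)\<bar> \<ge> 6 * (1 / 4 ^ n)"
      unfolding e using s[of k] s[of k'] by linarith
    moreover have "8 / 4 ^ Suc n \<le> 6 * (1 / (4::real) ^ n)"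
      by (simp add: divide_simps)
    ultimately show ?thesis by linarith
  next
    case False
    then have "cpart k n = cpart k' n" by (intro cpart_cong) blast
    moreover have "k n \<noteq> k' n" using False Suc.prems by (metis less_SucE)
    ultimately show ?thesis
      unfolding e by (auto simp add: s_def divide_simps)
  qed
qed simp

lemma inj_cpoint: "inj cpoint"
proof (rule injI, rule ext, rule ccontr)
  fix k k' i assume eq: "cpoint k = cpoint k'" and i: "k i \<noteq> k' i"
  have "\<bar>cpart k (Suc i) - cpart k' (Suc i)\<bar> \<ge> 8 * (1 / 4 ^ Suc i)"
    using cpart_separated[of "Suc i" k k'] i by auto
  moreover have "\<bar>cpoint k - cpart k (Suc i)\<bar> \<le> (4/3) * (1 / 4 ^ Suc i)"
    "\<bar>cpoint k' - cpart k' (Suc i)\<bar> \<le> (4/3) * (1 / 4 ^ Suc i)"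
    using cpoint_cpart[of k "Suc i"] cpoint_cpart[of k' "Suc i"] by simp_all
  moreover have "(0::real) < 1 / 4 ^ Suc i" by simp
  ultimately show False using eq by linarith
qed

lemma inverse_power_4_small: "e > 0 \<Longrightarrow> \<exists>n. 1 / 4 ^ n < (e::real)"
  using real_arch_pow_inv[of e "1/4"] by (simp add: power_one_over)

definition cset :: "complex set" where
  "cset = range (\<lambda>k. complex_of_real (cpoint k))"

lemma compact_cset: "compact cset"
proof -
  have "continuous_map Cantor_space euclidean cpoint"
    unfolding continuous_map_def
  proof (intro conjI allI impI)
    fix U :: "real set" assume U: "openin euclidean U"
    show "openin Cantor_space {k \<in> topspace Cantor_space. cpoint k \<in> U}"
    proof (subst openin_subopen, intro ballI)
      fix k assume k: "k \<in> {k \<in> topspace Cantor_space. cpoint k \<in> U}"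
      then obtain e where e: "e > 0" "ball (cpoint k) e \<subseteq> U"
        using U openE by auto
      \<comment> \<open>Points agreeing in \<open>n\<close> digits are at most \<open>8/3\<close>
        units of \<open>1 / 4 ^ n\<close> apart, and \<open>8/3 < 4\<close>.\<close>
      obtain n where n: "1 / 4 ^ n < e / 4"
        using inverse_power_4_small[of "e/4"] e(1) by auto
      have "cpoint k' \<in> U" if "\<forall>i<n. k' i = k i" for k'
      proof -
        have "cpart k' n = cpart k n" using that by (intro cpart_cong) auto
        moreover have "\<bar>cpoint k - cpart k n\<bar> \<le> (4/3) * (1 / 4 ^ n)"
          "\<bar>cpoint k' - cpart k' n\<bar> \<le> (4/3) * (1 / 4 ^ n)"
          using cpoint_cpart[of k n] cpoint_cpart[of k' n] by simp_all
        ultimately have "\<bar>cpoint k - cpoint k'\<bar> < e" using n by linarith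
        then show ?thesis using e(2) by (auto simp: dist_real_def)
      qed
      then show "\<exists>T. openin Cantor_space T \<and> k \<in> T \<and> T \<subseteq> {k \<in> topspace Cantor_space. cpoint k \<in> U}"
        using openin_cylinder[of n k] by (intro exI[of _ "{k'. \<forall>i<n. k' i = k i}"]) (auto simp: Cantor_space_def)
    qed
  qed simp
  moreover have "compact_space Cantor_space"
    by (auto simp: Cantor_space_def compact_space_product_topology compact_space_discrete_topology)
  then have "compactin Cantor_space UNIV"
    by (simp add: compact_space_def Cantor_space_def)
  ultimately have "compact (range cpoint)"
    using image_compactin[of Cantor_space UNIV euclidean cpoint] by simp
  then have "compact (complex_of_real ` range cpoint)"
    by (rule compact_continuous_image[rotated]) (rule continuous_on_of_real_id)
  then show ?thesis by (simp add: cset_def image_image)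
qed

lemma cpoint_in_cset [simp]: "complex_of_real (cpoint k) \<in> cset"
  by (simp add: cset_def)

text \<open>Level 0 bounds the modulus by 4/3; level 1 puts the point within 1/3 of 1 or -1. The
  chart at infinity relies on both.\<close>

lemma csetD:
  assumes "z \<in> cset" shows "Im z = 0" "norm z < 2" "z \<noteq> 0"
proof -
  obtain k where k: "z = complex_of_real (cpoint k)" using assms by (auto simp: cset_def)
  have "\<bar>cpoint k\<bar> \<le> 4/3" using cpoint_cpart[of k 0] by (simp add: cpart_def)
  moreover have "\<bar>cpoint k - (if k 0 then 1 else -1)\<bar> \<le> 1/3" using cpoint_cpart[of k 1] by (simp add: cpart_def)
  ultimately show "Im z = 0" "norm z < 2" "z \<noteq> 0" unfolding k by (auto split: if_splits)
qed

section \<open>The surface\<close>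

text \<open>The points \<open>fin_pt z\<close> with \<open>z \<notin> cset\<close> and \<open>inf_pt\<close> form the Riemann sphere without the Cantor
  set. For each \<open>k\<close> the half-plane of the points \<open>pr_pt k w\<close> with \<open>Im w \<le> 0\<close> is glued in at \<open>cpoint k\<close>:
  its boundary point \<open>pr_pt k u\<close> is the limit of the ray of inverse slope \<open>u\<close> leaving \<open>cpoint k\<close> into
  the upper half-plane. The first coordinate tells the three kinds of points apart.\<close>

definition fin_pt :: "complex \<Rightarrow> nat \<Rightarrow> real" where
  "fin_pt z = (\<lambda>n. if n = 1 then Re z else if n = 2 then Im z else 0)"

definition inf_pt :: "nat \<Rightarrow> real" where
  "inf_pt = (\<lambda>n. if n = 0 then 1 else 0)"

definition pr_pt :: "(nat \<Rightarrow> bool) \<Rightarrow> complex \<Rightarrow> nat \<Rightarrow> real" where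
  "pr_pt k w = (\<lambda>n. if n = 0 then 2 else if n = 1 then Re w else if n = 2 then Im w else of_bool (k (n - 3)))"

lemma fin_pt_inject [simp]: "fin_pt z = fin_pt z' \<longleftrightarrow> z = z'"
proof
  assume "fin_pt z = fin_pt z'"
  then have "fin_pt z 1 = fin_pt z' 1" "fin_pt z 2 = fin_pt z' 2" by simp_all
  then show "z = z'" by (simp add: fin_pt_def complex_eq_iff)
qed simp

lemma pr_pt_inject [simp]: "pr_pt k w = pr_pt k' w' \<longleftrightarrow> k = k' \<and> w = w'"
proof
  assume eq: "pr_pt k w = pr_pt k' w'"
  then have "pr_pt k w 1 = pr_pt k' w' 1" "pr_pt k w 2 = pr_pt k' w' 2" by simp_all
  then have "w = w'" by (simp add: pr_pt_def complex_eq_iff)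
  moreover have "k i = k' i" for i
  proof -
    have "pr_pt k w (i + 3) = pr_pt k' w' (i + 3)" using eq by simp
    then show ?thesis by (simp add: pr_pt_def of_bool_def split: if_splits)
  qed
  ultimately show "k = k' \<and> w = w'" by auto
qed simp

lemma pt_distinct [simp]:
  "fin_pt z \<noteq> inf_pt" "inf_pt \<noteq> fin_pt z" "fin_pt z \<noteq> pr_pt k w" "pr_pt k w \<noteq> fin_pt z"
  "inf_pt \<noteq> pr_pt k w" "pr_pt k w \<noteq> inf_pt"
proof -
  have "fin_pt z 0 = 0" "inf_pt 0 = 1" "pr_pt k w 0 = 2"
    by (simp_all add: fin_pt_def inf_pt_def pr_pt_def)
  then show "fin_pt z \<noteq> inf_pt" "inf_pt \<noteq> fin_pt z" "fin_pt z \<noteq> pr_pt k w" "pr_pt k w \<noteq> fin_pt z"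
    "inf_pt \<noteq> pr_pt k w" "pr_pt k w \<noteq> inf_pt"
    by (metis zero_neq_one zero_neq_numeral one_eq_numeral_iff semiring_norm(83))+
qed

datatype chart_index = Main | AtInf | Pruefer "nat \<Rightarrow> bool"

text \<open>The Pruefer coordinate change: above the axis, the vertical line over \<open>u\<close>
  goes to the ray of inverse slope \<open>u\<close> from \<open>cpoint k\<close>. The truncation by
  \<open>max\<close> extends the map continuously, collapsing the closed lower half-plane to
  \<open>cpoint k\<close>.\<close>

definition wedge :: "(nat \<Rightarrow> bool) \<Rightarrow> complex \<Rightarrow> complex" where
  "wedge k w = Complex (cpoint k + max (Im w) 0 * Re w) (max (Im w) 0)"

definition unwedge :: "(nat \<Rightarrow> bool) \<Rightarrow> complex \<Rightarrow> complex" where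
  "unwedge k z = Complex ((Re z - cpoint k) / Im z) (Im z)"

text \<open>\<open>0\<close> lies in the domain of the chart at infinity because \<open>1 / 0 = 0\<close> and \<open>0 \<notin> cset\<close>.\<close>

fun sdom :: "chart_index \<Rightarrow> complex set" where
  "sdom Main = - cset"
| "sdom AtInf = {w. 1 / w \<notin> cset}"
| "sdom (Pruefer k) = UNIV"

fun schart :: "chart_index \<Rightarrow> complex \<Rightarrow> nat \<Rightarrow> real" where
  "schart Main z = fin_pt z"
| "schart AtInf w = (if w = 0 then inf_pt else fin_pt (1 / w))"
| "schart (Pruefer k) w = (if Im w > 0 then fin_pt (wedge k w) else pr_pt k w)"

lemma Im_wedge: "Im (wedge k w) = max (Im w) 0"
  by (simp add: wedge_def)

lemma Re_wedge: "Re (wedge k w) = cpoint k + max (Im w) 0 * Re w"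
  by (simp add: wedge_def)

lemma wedge_nonpos: "Im w \<le> 0 \<Longrightarrow> wedge k w = complex_of_real (cpoint k)"
  by (simp add: wedge_def complex_eq_iff)

lemma wedge_eq_iff: "Im w > 0 \<Longrightarrow> wedge k w = z \<longleftrightarrow> Im z > 0 \<and> w = unwedge k z"
  by (auto simp: wedge_def unwedge_def complex_eq_iff field_simps)

lemma wedge_unwedge: "Im z > 0 \<Longrightarrow> wedge k (unwedge k z) = z"
  by (auto simp: wedge_def unwedge_def complex_eq_iff)

lemma Im_unwedge [simp]: "Im (unwedge k z) = Im z"
  by (simp add: unwedge_def)

lemma Im_pos_notin_cset: "Im z > 0 \<Longrightarrow> z \<notin> cset" "Im z < 0 \<Longrightarrow> z \<notin> cset"
  using csetD(1) by force+

lemma zero_notin_cset: "0 \<notin> cset"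
  using csetD(3) by blast

lemma continuous_wedge: "continuous_on S (wedge k)"
  unfolding wedge_def Complex_eq by (intro continuous_intros)

lemma continuous_unwedge: "continuous_on {z. Im z > 0} (unwedge k)"
  unfolding unwedge_def Complex_eq by (intro continuous_intros) auto

section \<open>Compatibility of the charts\<close>

lemma inj_schart: "inj_on (schart i) (sdom i)"
proof (cases i)
  case (Pruefer k)
  have "w = w'" if "Im w > 0" "Im w' > 0" "wedge k w = wedge k w'" for w w'
    using that wedge_eq_iff[of w k] wedge_eq_iff[of w' k] by metis
  then show ?thesis
    using Pruefer by (auto simp: inj_on_def)
qed (auto simp: inj_on_def)

lemma fin_pt_in_schart_image:
  "fin_pt z \<in> schart Main ` G \<longleftrightarrow> z \<in> G"
  "fin_pt z \<in> schart AtInf ` G \<longleftrightarrow> z \<noteq> 0 \<and> 1 / z \<in> G"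
  "fin_pt z \<in> schart (Pruefer k) ` G \<longleftrightarrow> Im z > 0 \<and> unwedge k z \<in> G"
proof -
  show "fin_pt z \<in> schart Main ` G \<longleftrightarrow> z \<in> G" by auto
  show "fin_pt z \<in> schart AtInf ` G \<longleftrightarrow> z \<noteq> 0 \<and> 1 / z \<in> G"
  proof
    assume "z \<noteq> 0 \<and> 1 / z \<in> G"
    then show "fin_pt z \<in> schart AtInf ` G"
      by (intro image_eqI[of _ _ "1 / z"]) auto
  qed (auto split: if_splits)
  show "fin_pt z \<in> schart (Pruefer k) ` G \<longleftrightarrow> Im z > 0 \<and> unwedge k z \<in> G"
  proof
    assume "Im z > 0 \<and> unwedge k z \<in> G"
    then show "fin_pt z \<in> schart (Pruefer k) ` G"
      by (intro image_eqI[of _ _ "unwedge k z"]) (auto simp: wedge_unwedge)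
  next
    assume "fin_pt z \<in> schart (Pruefer k) ` G"
    then obtain w where "w \<in> G" "Im w > 0" "wedge k w = z" by (auto split: if_splits)
    then show "Im z > 0 \<and> unwedge k z \<in> G" using wedge_eq_iff by metis
  qed
qed

lemma inf_pt_in_schart_image:
  "inf_pt \<in> schart i ` G \<longleftrightarrow> i = AtInf \<and> 0 \<in> G"
  by (cases i) (auto split: if_splits)

lemma pr_pt_in_schart_image:
  "pr_pt k w \<in> schart i ` G \<longleftrightarrow> i = Pruefer k \<and> Im w \<le> 0 \<and> w \<in> G"
proof (cases i)
  case (Pruefer k')
  show ?thesis
  proof
    assume "i = Pruefer k \<and> Im w \<le> 0 \<and> w \<in> G"
    then show "pr_pt k w \<in> schart i ` G" by (intro image_eqI[of _ _ w]) auto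
  qed (use Pruefer in \<open>auto split: if_splits\<close>)
qed (auto split: if_splits)

lemma open_compl_cset: "open (- cset)"
  by (simp add: open_Compl compact_imp_closed compact_cset)

lemma open_Im_pos: "open {z. Im z > 0}"
  by (simp add: open_halfspace_Im_gt)

lemma open_inverse_preimage: "open G \<Longrightarrow> open {w :: complex. w \<noteq> 0 \<and> 1 / w \<in> G}"
proof -
  assume "open G"
  moreover have "continuous_on (- {0 :: complex}) (\<lambda>w. 1 / w)" by (intro continuous_intros) auto
  ultimately have "open (- {0 :: complex} \<inter> (\<lambda>w. 1 / w) -` G)"
    by (intro continuous_open_preimage) auto
  moreover have "- {0 :: complex} \<inter> (\<lambda>w. 1 / w) -` G = {w. w \<noteq> 0 \<and> 1 / w \<in> G}" by auto
  ultimately show ?thesis by simp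
qed

lemma open_wedge_preimage: "open G \<Longrightarrow> open {w. Im w > 0 \<and> wedge k w \<in> G}"
proof -
  assume "open G"
  then have "open ({w. Im w > 0} \<inter> wedge k -` G)"
    by (intro continuous_open_preimage continuous_wedge open_Im_pos)
  moreover have "{w. Im w > 0} \<inter> wedge k -` G = {w. Im w > 0 \<and> wedge k w \<in> G}" by auto
  ultimately show ?thesis by simp
qed

lemma open_unwedge_preimage: "open G \<Longrightarrow> open {w. Im w > 0 \<and> unwedge k w \<in> G}"
proof -
  assume "open G"
  then have "open ({w. Im w > 0} \<inter> unwedge k -` G)"
    by (intro continuous_open_preimage continuous_unwedge open_Im_pos)
  moreover have "{w. Im w > 0} \<inter> unwedge k -` G = {w. Im w > 0 \<and> unwedge k w \<in> G}" by auto
  ultimately show ?thesis by simp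
qed

text \<open>Inversion carries the punctured disc outside radius 2, where there are no Cantor
  points.\<close>

lemma ball_subset_sdom_AtInf: "ball 0 (1/2) \<subseteq> sdom AtInf"
proof
  fix w :: complex assume w: "w \<in> ball 0 (1/2)"
  have "norm (1 / w) > 2" if "w \<noteq> 0"
    using w that by (simp add: norm_divide field_simps)
  then show "w \<in> sdom AtInf"
    using csetD(2)[of "1 / w"] csetD(3) by (cases "w = 0") force+
qed

lemma open_sdom: "open (sdom i)"
proof (cases i)
  case AtInf
  \<comment> \<open>Inversion is not continuous at 0, so openness there needs a separate
    disc.\<close>
  have "sdom AtInf = {w. w \<noteq> 0 \<and> 1 / w \<in> - cset} \<union> ball 0 (1/2)"
    using ball_subset_sdom_AtInf zero_notin_cset by auto
  then show ?thesis
    using AtInf open_inverse_preimage[OF open_compl_cset] by auto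
qed (auto simp: open_compl_cset)

lemma open_fin_pt_preimage:
  assumes "open G" "G \<inter> cset = {}"
  shows "open {z \<in> sdom i. schart i z \<in> fin_pt ` G}"
proof (cases i)
  case Main
  then have "{z \<in> sdom i. schart i z \<in> fin_pt ` G} = G" using assms(2) by auto
  then show ?thesis using assms by simp
next
  case AtInf
  then have "{z \<in> sdom i. schart i z \<in> fin_pt ` G} = {w. w \<noteq> 0 \<and> 1 / w \<in> G}"
    using assms(2) by (auto split: if_splits)
  then show ?thesis using open_inverse_preimage[OF assms(1)] by simp
next
  case (Pruefer k)
  then have "{z \<in> sdom i. schart i z \<in> fin_pt ` G} = {w. Im w > 0 \<and> wedge k w \<in> G}"
    by (auto split: if_splits)
  then show ?thesis using open_wedge_preimage[OF assms(1)] by simp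
qed

text \<open>Distinct charts overlap in finite points only, so only the finite points of the image of
  \<open>G\<close> matter.\<close>

lemma open_transition:
  assumes G: "open G" "G \<subseteq> sdom j"
  shows "open {z \<in> sdom i. schart i z \<in> schart j ` G}"
proof -
  define F where "F = {z. fin_pt z \<in> schart j ` G}"
  have F: "open F \<and> F \<inter> cset = {}"
  proof (cases j)
    case Main
    have "F = G"
      unfolding F_def Main fin_pt_in_schart_image by simp
    then show ?thesis using G Main by auto
  next
    case AtInf
    have "F = {w. w \<noteq> 0 \<and> 1 / w \<in> G}"
      unfolding F_def AtInf fin_pt_in_schart_image by simp
    moreover have "{w. w \<noteq> 0 \<and> 1 / w \<in> G} \<inter> cset = {}"
      using G(2) AtInf by auto
    ultimately show ?thesis using open_inverse_preimage[OF G(1)] by simp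
  next
    case (Pruefer k)
    have "F = {w. Im w > 0 \<and> unwedge k w \<in> G}"
      unfolding F_def Pruefer fin_pt_in_schart_image by simp
    then show ?thesis using open_unwedge_preimage[OF G(1)] Im_pos_notin_cset(1) by auto
  qed
  show ?thesis
  proof (cases "i = j")
    case True
    then have "{z \<in> sdom i. schart i z \<in> schart j ` G} = G"
      using G(2) inj_on_image_mem_iff[OF inj_schart _ G(2)] by blast
    then show ?thesis using G by simp
  next
    case False
    have fin: "fin_pt u \<in> fin_pt ` F \<longleftrightarrow> fin_pt u \<in> schart j ` G" for u
      unfolding F_def by auto
    have "schart i z \<in> schart j ` G \<longleftrightarrow> schart i z \<in> fin_pt ` F" for z
    proof (cases i)
      case Main
      then show ?thesis using fin by simp
    next
      case AtInf
      moreover have "inf_pt \<notin> schart j ` G" using False AtInf inf_pt_in_schart_image by metis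
      moreover have "inf_pt \<notin> fin_pt ` F" by auto
      ultimately show ?thesis using fin by simp
    next
      case (Pruefer k)
      moreover have "pr_pt k z \<notin> schart j ` G" using False Pruefer pr_pt_in_schart_image by metis
      moreover have "pr_pt k z \<notin> fin_pt ` F" by auto
      ultimately show ?thesis using fin by simp
    qed
    then show ?thesis
      using open_fin_pt_preimage[of F i] F by simp
  qed
qed

interpretation surface: atlas sdom schart
  by unfold_locales (auto simp: open_sdom inj_schart open_transition)

abbreviation surface :: "(nat \<Rightarrow> real) topology" where
  "surface \<equiv> surface.glued"

section \<open>Points, open sets and separation on the surface\<close>

lemma fin_pt_in_surface: "fin_pt z \<in> topspace surface \<longleftrightarrow> z \<notin> cset"
proof
  assume "fin_pt z \<in> topspace surface"
  then obtain i where i: "fin_pt z \<in> schart i ` sdom i"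
    unfolding surface.topspace_glued by blast
  show "z \<notin> cset"
    by (cases i) (use i Im_pos_notin_cset in \<open>auto simp del: schart.simps simp: fin_pt_in_schart_image\<close>)
next
  assume "z \<notin> cset"
  then have "fin_pt z \<in> schart Main ` sdom Main" by (simp add: fin_pt_in_schart_image)
  then show "fin_pt z \<in> topspace surface"
    unfolding surface.topspace_glued by blast
qed

lemma pr_pt_in_surface: "pr_pt k w \<in> topspace surface \<longleftrightarrow> Im w \<le> 0"
  unfolding surface.topspace_glued UN_iff pr_pt_in_schart_image by auto

lemma surface_cases:
  assumes x: "x \<in> topspace surface"
  obtains z where "x = fin_pt z" "z \<notin> cset" | "x = inf_pt" | k w where "x = pr_pt k w" "Im w \<le> 0"
proof -
  obtain i v where v: "x = schart i v"
    using x unfolding surface.topspace_glued by blast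
  consider z where "x = fin_pt z" | "x = inf_pt" | k w where "x = pr_pt k w"
    using v by (cases i) (auto split: if_splits)
  then show ?thesis
    by cases (use that x fin_pt_in_surface pr_pt_in_surface in auto)
qed

text \<open>The preimage of a planar set under the map collapsing each glued-in half-plane to its point of
  the Cantor set.\<close>

definition over :: "complex set \<Rightarrow> (nat \<Rightarrow> real) set" where
  "over G = fin_pt ` (G - cset) \<union> {pr_pt k w | k w. Im w \<le> 0 \<and> complex_of_real (cpoint k) \<in> G}"

lemma in_over [simp]:
  "fin_pt z \<in> over G \<longleftrightarrow> z \<in> G \<and> z \<notin> cset"
  "pr_pt k w \<in> over G \<longleftrightarrow> Im w \<le> 0 \<and> complex_of_real (cpoint k) \<in> G"
  "inf_pt \<notin> over G"
  by (auto simp: over_def)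

lemma over_subset: "over G \<subseteq> topspace surface"
  by (auto simp: over_def fin_pt_in_surface pr_pt_in_surface)

text \<open>In this chart the collapse is \<open>wedge k\<close> on the whole plane, thanks to the
  truncation; its continuity is what makes \<open>over G\<close> open.\<close>

lemma schart_Pruefer_in_over: "schart (Pruefer k) w \<in> over G \<longleftrightarrow> wedge k w \<in> G"
  using Im_pos_notin_cset(1)[of "wedge k w"] by (auto simp: Im_wedge wedge_nonpos)

lemma openin_over:
  assumes "open G"
  shows "openin surface (over G)"
  unfolding surface.openin_glued
proof (intro conjI allI)
  show "over G \<subseteq> (\<Union>i. schart i ` sdom i)"
    using over_subset by (simp add: surface.topspace_glued)
  fix i
  show "open {z \<in> sdom i. schart i z \<in> over G}"
  proof (cases i)
    case Main
    then have "{z \<in> sdom i. schart i z \<in> over G} = G - cset" by auto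
    then show ?thesis using assms open_compl_cset by (simp add: Diff_eq open_Int)
  next
    case AtInf
    then have "{z \<in> sdom i. schart i z \<in> over G} = {w. w \<noteq> 0 \<and> 1 / w \<in> G - cset}"
      by (auto split: if_splits)
    then show ?thesis
      using open_inverse_preimage[of "G - cset"] assms open_compl_cset by (simp add: Diff_eq open_Int)
  next
    case (Pruefer k)
    then have "{z \<in> sdom i. schart i z \<in> over G} = wedge k -` G"
      by (auto simp del: schart.simps simp: schart_Pruefer_in_over)
    then show ?thesis
      using continuous_open_preimage[OF continuous_wedge[of UNIV] open_UNIV assms] by simp
  qed
qed

definition near_inf :: "real \<Rightarrow> (nat \<Rightarrow> real) set" where
  "near_inf r = schart AtInf ` ball 0 r"

lemma in_near_inf [simp]:
  assumes "r > 0"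
  shows "fin_pt z \<in> near_inf r \<longleftrightarrow> norm z > 1 / r" "inf_pt \<in> near_inf r" "pr_pt k w \<notin> near_inf r"
proof -
  have "z \<noteq> 0 \<and> norm (1 / z) < r \<longleftrightarrow> norm z > 1 / r"
  proof (cases "z = 0")
    case False
    then show ?thesis using assms by (simp add: norm_divide field_simps)
  qed (use assms in \<open>auto simp: not_less\<close>)
  then show "fin_pt z \<in> near_inf r \<longleftrightarrow> norm z > 1 / r"
    unfolding near_inf_def fin_pt_in_schart_image by simp
  show "inf_pt \<in> near_inf r"
    unfolding near_inf_def inf_pt_in_schart_image using assms by simp
  show "pr_pt k w \<notin> near_inf r"
    unfolding near_inf_def pr_pt_in_schart_image by simp
qed

lemma openin_near_inf: "r \<le> 1/2 \<Longrightarrow> openin surface (near_inf r)"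
  unfolding near_inf_def
  using surface.openin_chart_image[of "ball 0 r" AtInf] ball_subset_sdom_AtInf subset_ball[of r "1/2" 0] by auto

text \<open>Points with different images under the collapse are separated in the plane,
  \<open>inf_pt\<close> by a large circle, and two points of one half-plane in their common
  chart.\<close>

lemma Hausdorff_surface: "Hausdorff_space surface"
proof -
  define P where "P x y \<longleftrightarrow> (\<exists>U V. openin surface U \<and> openin surface V \<and> x \<in> U \<and> y \<in> V \<and> disjnt U V)" for x y
  have sym: "P y x" if "P x y" for x y
    using that unfolding P_def by (metis disjnt_sym)
  have ov: "P x y" if xy: "x \<in> over {p}" "y \<in> over {q}" and pq: "p \<noteq> q" for x y p q
  proof -
    obtain U V where "open U" "open V" "p \<in> U" "q \<in> V" "U \<inter> V = {}"
      using hausdorff[OF pq] by blast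
    moreover from this have "x \<in> over U" "y \<in> over V" "disjnt (over U) (over V)"
      using xy by (auto simp: over_def disjnt_def)
    ultimately show ?thesis
      unfolding P_def using openin_over by blast
  qed
  have inf: "P inf_pt y" if "y \<in> over {p}" for y p
  proof -
    \<comment> \<open>The summand 2 ensures \<open>1 / R \<le> 1/2\<close>, as
      \<open>openin_near_inf\<close> demands.\<close>
    define R where "R = norm p + 2"
    have "y \<in> over (ball 0 R)" using that by (auto simp: over_def R_def)
    moreover have R: "R > 0" "1 / R \<le> 1/2"
    proof -
      have "R \<ge> 2" by (simp add: R_def)
      then show "R > 0" "1 / R \<le> 1/2" by (simp_all add: field_simps)
    qed
    moreover have "disjnt (near_inf (1 / R)) (over (ball 0 R))"
      using R by (auto simp: over_def disjnt_def)
    ultimately show ?thesis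
      unfolding P_def using openin_over[OF open_ball] openin_near_inf in_near_inf(2)
      by (metis zero_less_divide_1_iff)
  qed
  have proj: "x = inf_pt \<or> (\<exists>p. x \<in> over {p})" if "x \<in> topspace surface" for x
    using that by (cases rule: surface_cases) auto
  have pr: "P (pr_pt k w) (pr_pt k w')" if im: "Im w \<le> 0" "Im w' \<le> 0" and ne: "w \<noteq> w'" for k w w'
  proof -
    obtain U V where "open U" "open V" "w \<in> U" "w' \<in> V" "U \<inter> V = {}"
      using hausdorff[OF ne] by blast
    moreover from this have "disjnt (schart (Pruefer k) ` U) (schart (Pruefer k) ` V)"
      using inj_on_image_Int[OF inj_schart[of "Pruefer k"], of U V] by (simp add: disjnt_def)
    ultimately show ?thesis
      unfolding P_def using im surface.openin_chart_image[of _ "Pruefer k"]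
      by (intro exI[of _ "schart (Pruefer k) ` U"] exI[of _ "schart (Pruefer k) ` V"])
        (auto simp del: schart.simps simp: pr_pt_in_schart_image)
  qed
  have "P x y" if xy: "x \<in> topspace surface" "y \<in> topspace surface" "x \<noteq> y" for x y
  proof (cases "x = inf_pt \<or> y = inf_pt")
    case True
    then show ?thesis using proj xy inf sym by metis
  next
    case False
    then obtain p q where pq: "x \<in> over {p}" "y \<in> over {q}" using proj xy by metis
    show ?thesis
    proof (cases "p = q")
      case True
      \<comment> \<open>A fibre of the collapse with two points can only be a glued
        half-plane.\<close>
      then obtain k w w' where "x = pr_pt k w" "y = pr_pt k w'" "Im w \<le> 0" "Im w' \<le> 0"
        using pq xy(3) inj_cpoint by (auto simp: over_def inj_eq)
      then show ?thesis using pr xy(3) by auto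
    qed (use ov pq in blast)
  qed
  then show ?thesis
    unfolding Hausdorff_space_def P_def by blast
qed

section \<open>The ends of the surface\<close>

text \<open>The partial sums of different digit sequences are at least \<open>8 / 4 ^ n\<close> apart, consecutive
  partial sums are \<open>1 / 4 ^ n\<close> apart: with radius \<open>2 / 4 ^ n\<close> the discs of one level have disjoint
  closures and those of consecutive levels are nested.\<close>

definition disc :: "(nat \<Rightarrow> bool) \<Rightarrow> nat \<Rightarrow> complex set" where
  "disc k n = ball (complex_of_real (cpart k n)) (2 / 4 ^ n)"

definition cell :: "(nat \<Rightarrow> bool) \<Rightarrow> nat \<Rightarrow> (nat \<Rightarrow> real) set" where
  "cell k n = over (disc k n)"

text \<open>The boxes exhaust the chart. Their half-width exceeds 2, so the upper edge stays above
  every disc; that it is at least 3 enters the estimates for connectedness.\<close>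

definition box :: "nat \<Rightarrow> complex set" where
  "box n = cbox (Complex (- (real n + 3)) (- (real n + 3))) (Complex (real n + 3) (real n + 3))"

definition plug :: "(nat \<Rightarrow> bool) \<Rightarrow> nat \<Rightarrow> (nat \<Rightarrow> real) set" where
  "plug k n = schart (Pruefer k) ` box n"

lemma in_box: "w \<in> box n \<longleftrightarrow> \<bar>Re w\<bar> \<le> real n + 3 \<and> \<bar>Im w\<bar> \<le> real n + 3"
  by (auto simp: box_def in_cbox_complex_iff)

lemma dist_real_complex: "dist (complex_of_real x) (complex_of_real y) = \<bar>x - y\<bar>"
  by (simp add: dist_norm flip: of_real_diff)

lemma abs_Re_Im_disc:
  assumes "z \<in> disc k n"
  shows "\<bar>Re z - cpart k n\<bar> < 2 / 4 ^ n" "\<bar>Im z\<bar> < 2 / 4 ^ n"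
proof -
  have "norm (z - complex_of_real (cpart k n)) < 2 / 4 ^ n"
    using assms by (simp add: disc_def dist_norm norm_minus_commute)
  then show "\<bar>Re z - cpart k n\<bar> < 2 / 4 ^ n" "\<bar>Im z\<bar> < 2 / 4 ^ n"
    using abs_Re_le_cmod[of "z - complex_of_real (cpart k n)"]
      abs_Im_le_cmod[of "z - complex_of_real (cpart k n)"] by simp_all
qed

lemma Complex_in_disc:
  assumes "(x - cpart k n)\<^sup>2 + y\<^sup>2 < (2 / 4 ^ n)\<^sup>2"
  shows "Complex x y \<in> disc k n"
proof -
  have "norm (complex_of_real (cpart k n) - Complex x y) = sqrt ((cpart k n - x)\<^sup>2 + y\<^sup>2)"
    by (simp add: cmod_def)
  also have "\<dots> < 2 / 4 ^ n"
    using assms by (intro real_less_lsqrt) (auto simp: power2_commute)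
  finally show ?thesis
    by (simp add: disc_def dist_norm)
qed

lemma cpoint_in_disc: "complex_of_real (cpoint k) \<in> disc k n"
proof -
  have "\<bar>cpart k n - cpoint k\<bar> < 2 * (1 / 4 ^ n)"
    using cpoint_cpart[of k n] by (simp add: abs_minus_commute field_simps)
  then show ?thesis
    by (simp add: disc_def dist_real_def)
qed

text \<open>In units of \<open>1 / 4 ^ n\<close>, different initial digits would put the partial
  sums at least 8 apart, whereas remainder and radius add up to only \<open>4/3 + 2\<close>.\<close>

lemma cpoint_in_discD:
  assumes "complex_of_real (cpoint k') \<in> disc k n"
  shows "\<forall>i<n. k' i = k i"
proof (rule ccontr)
  assume "\<not> ?thesis"
  then have "\<bar>cpart k n - cpart k' n\<bar> \<ge> 8 * (1 / 4 ^ n)"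
    using cpart_separated[of n k k'] by (metis mult.right_neutral times_divide_eq_right)
  moreover have "\<bar>cpoint k' - cpart k' n\<bar> \<le> (4/3) * (1 / 4 ^ n)"
    using cpoint_cpart[of k' n] by simp
  moreover have "\<bar>cpart k n - cpoint k'\<bar> < 2 * (1 / 4 ^ n)"
    using assms by (simp add: disc_def dist_real_def)
  moreover have "(0::real) < 1 / 4 ^ n" by simp
  ultimately show False by linarith
qed

text \<open>Boundedness of \<open>G\<close> leaves a neighbourhood of \<open>inf_pt\<close> in the
  complement.\<close>

lemma closedin_over:
  assumes "closed G" "bounded G"
  shows "closedin surface (over G)"
proof -
  obtain R0 where "\<forall>z\<in>G. norm z \<le> R0"
    using assms(2) by (auto simp: bounded_iff)
  define R where "R = max R0 2"
  have R: "R \<ge> 2" "\<And>z. z \<in> G \<Longrightarrow> norm z \<le> R"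
    using \<open>\<forall>z\<in>G. norm z \<le> R0\<close> by (auto simp: R_def)
  have r: "1 / R > 0" "1 / R \<le> 1 / 2" using R(1) by (simp_all add: field_simps)
  have op: "openin surface (over (- G) \<union> near_inf (1 / R))"
    using assms(1) r by (intro openin_Un openin_over openin_near_inf) auto
  have "topspace surface - over G = over (- G) \<union> near_inf (1 / R)"
  proof (intro set_eqI iffI)
    fix x assume "x \<in> topspace surface - over G"
    then have "x \<in> topspace surface" "x \<notin> over G" by auto
    then show "x \<in> over (- G) \<union> near_inf (1 / R)"
      using r by (cases rule: surface_cases) auto
  next
    fix x assume x: "x \<in> over (- G) \<union> near_inf (1 / R)"
    then have xt: "x \<in> topspace surface"
      using openin_subset[OF op] by blast
    then show "x \<in> topspace surface - over G"
      by (cases rule: surface_cases) (use x r R(2) xt in force)+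
  qed
  then show ?thesis
    using op over_subset by (simp add: closedin_def)
qed

lemma closure_cell:
  "surface closure_of cell k n \<subseteq> over (cball (complex_of_real (cpart k n)) (2 / 4 ^ n))"
proof (rule closure_of_minimal)
  show "cell k n \<subseteq> over (cball (complex_of_real (cpart k n)) (2 / 4 ^ n))"
    unfolding cell_def disc_def over_def by (auto simp: less_imp_le)
qed (simp add: closedin_over)

lemma closure_cell_Suc: "surface closure_of cell k (Suc n) \<subseteq> cell k n"
proof -
  have "cball (complex_of_real (cpart k (Suc n))) (2 / 4 ^ Suc n) \<subseteq> disc k n"
  proof
    fix z assume "z \<in> cball (complex_of_real (cpart k (Suc n))) (2 / 4 ^ Suc n)"
    moreover have "dist (complex_of_real (cpart k n)) (complex_of_real (cpart k (Suc n))) = 1 / 4 ^ n"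
      unfolding dist_real_complex by (simp add: cpart_Suc)
    moreover have "dist (complex_of_real (cpart k n)) z
        \<le> dist (complex_of_real (cpart k n)) (complex_of_real (cpart k (Suc n))) + dist (complex_of_real (cpart k (Suc n))) z"
      by (rule dist_triangle)
    ultimately have "dist (complex_of_real (cpart k n)) z \<le> 1 / 4 ^ n + 2 / 4 ^ Suc n" by simp
    also have "\<dots> < 2 / 4 ^ n" by (simp add: field_simps)
    finally show "z \<in> disc k n" by (simp add: disc_def)
  qed
  then have "over (cball (complex_of_real (cpart k (Suc n))) (2 / 4 ^ Suc n)) \<subseteq> cell k n"
    unfolding over_def cell_def by blast
  then show ?thesis
    using closure_cell by blast
qed

lemma over_Int: "over G \<inter> over H = over (G \<inter> H)"
  unfolding over_def by auto

lemma disjnt_closure_cell: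
  assumes "i < n" "k i \<noteq> k' i"
  shows "disjnt (surface closure_of cell k n) (surface closure_of cell k' n)"
proof -
  have d: "cball (complex_of_real (cpart k n)) (2 / 4 ^ n) \<inter> cball (complex_of_real (cpart k' n)) (2 / 4 ^ n) = {}"
  proof (rule ccontr)
    assume "\<not> ?thesis"
    then obtain z where "dist (complex_of_real (cpart k n)) z \<le> 2 * (1 / 4 ^ n)"
      "dist (complex_of_real (cpart k' n)) z \<le> 2 * (1 / 4 ^ n)" by auto
    then have "dist (complex_of_real (cpart k n)) (complex_of_real (cpart k' n)) \<le> 4 * (1 / 4 ^ n)"
      using dist_triangle2[of "complex_of_real (cpart k n)" "complex_of_real (cpart k' n)" z] by linarith
    moreover have "\<bar>cpart k n - cpart k' n\<bar> \<ge> 8 * (1 / 4 ^ n)"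
      using cpart_separated[of n k k'] assms by auto
    moreover have "(0::real) < 1 / 4 ^ n" by simp
    ultimately show False by (simp only: dist_real_complex)
  qed
  have "over (cball (complex_of_real (cpart k n)) (2 / 4 ^ n))
     \<inter> over (cball (complex_of_real (cpart k' n)) (2 / 4 ^ n)) = {}"
    unfolding over_Int d by (simp add: over_def)
  then show ?thesis
    using closure_cell[of k n] closure_cell[of k' n] unfolding disjnt_def by blast
qed

text \<open>The cells contain all glued half-planes. The rest is covered by two compact chart
  images: the disc of radius 4 without \<open>U\<close>, and its exterior together with
  \<open>inf_pt\<close>, read in the chart at infinity.\<close>

lemma compactin_compl_cells: "compactin surface (topspace surface - (\<Union>k. cell k n))"
proof -
  define U where "U = (\<Union>k. disc k n)"
  define C1 where "C1 = fin_pt ` (cball 0 4 - U)"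
  define C2 where "C2 = schart AtInf ` cball 0 (1/4)"
  have "open U" unfolding U_def disc_def by auto
  moreover have "cset \<subseteq> U" using cpoint_in_disc by (auto simp: U_def cset_def)
  ultimately have "compact (cball 0 4 - U)" "cball 0 4 - U \<subseteq> sdom Main"
    by (auto simp: compact_diff)
  then have "compactin surface (schart Main ` (cball 0 4 - U))"
    by (rule surface.compactin_chart_image)
  moreover have "schart Main ` (cball 0 4 - U) = C1" by (simp add: C1_def)
  moreover have "compactin surface C2"
    unfolding C2_def
    by (rule surface.compactin_chart_image) (use ball_subset_sdom_AtInf in \<open>auto simp: subset_iff\<close>)
  ultimately have C: "compactin surface (C1 \<union> C2)" by (simp add: compactin_Un)
  have "x \<in> C1 \<union> C2" if x: "x \<in> topspace surface - (\<Union>k. cell k n)" for x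
  proof -
    have "x \<in> topspace surface" using x by simp
    then show ?thesis
    proof (cases rule: surface_cases)
      case (1 z)
      have "z \<notin> U" using x 1 by (auto simp: cell_def U_def)
      show ?thesis
      proof (cases "norm z \<le> 4")
        case True
        then show ?thesis using 1 \<open>z \<notin> U\<close> by (simp add: C1_def)
      next
        case False
        then have "z \<noteq> 0" by auto
        moreover have "norm (1 / z) \<le> 1 / 4"
          unfolding norm_divide norm_one by (rule frac_le) (use False in auto)
        ultimately have "x \<in> C2" unfolding C2_def 1(1) fin_pt_in_schart_image by simp
        then show ?thesis by simp
      qed
    next
      case 2
      then have "x \<in> C2" unfolding C2_def 2 inf_pt_in_schart_image by simp
      then show ?thesis by simp
    next
      case (3 k w)
      then have "x \<in> cell k n" using cpoint_in_disc by (simp add: cell_def)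
      then show ?thesis using x by auto
    qed
  qed
  moreover have "closedin surface (topspace surface - (\<Union>k. cell k n))"
    unfolding cell_def disc_def by (intro closedin_diff closedin_topspace openin_Union) (auto intro: openin_over)
  ultimately show ?thesis
    using closed_compactin[OF C] by blast
qed

lemma plug_Suc: "plug k n \<subseteq> surface interior_of plug k (Suc n)"
proof -
  have "box n \<subseteq> interior (box (Suc n))"
    unfolding box_def interior_cbox by (auto simp: in_cbox_complex_iff in_box_complex_iff)
  then have "plug k n \<subseteq> schart (Pruefer k) ` interior (box (Suc n))"
    unfolding plug_def by blast
  also have "\<dots> \<subseteq> surface interior_of plug k (Suc n)"
    unfolding plug_def
    by (intro interior_of_maximal image_mono interior_subset surface.openin_chart_image) auto
  finally show ?thesis .
qed

text \<open>In the disc \<open>Im z < 2\<close>, so the upper edge of the box is out of reach: above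
  the axis the plug removes just the cone
  \<open>\<bar>Re z - cpoint k\<bar> \<le> (real n + 3) * Im z\<close>.\<close>

lemma fin_pt_in_tail:
  "fin_pt z \<in> cell k n - plug k n \<longleftrightarrow>
     z \<in> disc k n \<and> z \<notin> cset \<and> (Im z \<le> 0 \<or> \<bar>Re z - cpoint k\<bar> > (real n + 3) * Im z)"
proof (cases "z \<in> disc k n \<and> z \<notin> cset \<and> Im z > 0")
  case True
  have "2 / 4 ^ n \<le> (2 :: real)" by (simp add: divide_le_eq)
  then have "Im z < real n + 3"
    using abs_Re_Im_disc(2)[of z k n] True by linarith
  then have "unwedge k z \<in> box n \<longleftrightarrow> \<bar>Re z - cpoint k\<bar> \<le> (real n + 3) * Im z"
    using True by (simp add: in_box unwedge_def abs_divide divide_le_eq)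
  then show ?thesis
    using True unfolding plug_def Diff_iff fin_pt_in_schart_image by (simp add: cell_def not_le)
next
  case False
  then show ?thesis
    unfolding plug_def Diff_iff fin_pt_in_schart_image by (auto simp: cell_def)
qed

lemma pr_pt_in_tail:
  "pr_pt k' w \<in> cell k n - plug k n \<longleftrightarrow>
     Im w \<le> 0 \<and> complex_of_real (cpoint k') \<in> disc k n \<and> (k' \<noteq> k \<or> w \<notin> box n)"
  unfolding plug_def Diff_iff pr_pt_in_schart_image by (auto simp: cell_def)

lemma inf_pt_notin_tail: "inf_pt \<notin> cell k n - plug k n"
  by (simp add: cell_def)

text \<open>The discs shrink to \<open>cpoint k\<close>, which excludes finite points and the
  half-planes of other sequences; the boxes exhaust the half-plane of \<open>k\<close>
  itself.\<close>

lemma Inter_tails_empty: "(\<Inter>n. cell k n - plug k n) = {}"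
proof (rule ccontr)
  assume "\<not> ?thesis"
  then obtain x where x: "\<And>n. x \<in> cell k n - plug k n" by blast
  have lim: "z = complex_of_real (cpoint k)" if z: "\<And>n. z \<in> disc k n" for z
  proof (rule ccontr)
    assume "z \<noteq> complex_of_real (cpoint k)"
    \<comment> \<open>The divisor 4 is twice the radius 2: \<open>z\<close> and
      \<open>cpoint k\<close> both lie in a disc of radius \<open>2 / 4 ^ n\<close>.\<close>
    then have "dist z (complex_of_real (cpoint k)) / 4 > 0" by simp
    then obtain n where n: "1 / 4 ^ n < dist z (complex_of_real (cpoint k)) / 4"
      using inverse_power_4_small by blast
    have "dist z (complex_of_real (cpoint k)) < 2 / 4 ^ n + 2 / 4 ^ n"
      using z[of n] cpoint_in_disc[of k n]
        dist_triangle[of z "complex_of_real (cpoint k)" "complex_of_real (cpart k n)"]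
      by (simp add: disc_def dist_commute)
    then show False using n by (simp add: field_simps)
  qed
  have "x \<in> topspace surface"
    using x over_subset by (auto simp: cell_def)
  then show False
  proof (cases rule: surface_cases)
    case (1 z)
    have "z \<in> disc k n" for n
      using x[of n] unfolding 1(1) fin_pt_in_tail by simp
    then have "z = complex_of_real (cpoint k)" by (rule lim)
    then show False using 1(2) by simp
  next
    case 2
    then show False using x[of 0] inf_pt_notin_tail[of k 0] by simp
  next
    case (3 k' w)
    have *: "complex_of_real (cpoint k') \<in> disc k n \<and> (k' \<noteq> k \<or> w \<notin> box n)" for n
      using x[of n] unfolding 3(1) pr_pt_in_tail by simp
    then have "complex_of_real (cpoint k') = complex_of_real (cpoint k)"
      by (intro lim) simp
    then have "k' = k" using inj_cpoint by (simp add: inj_eq)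
    then have w: "w \<notin> box n" for n
      using * by simp
    obtain n where "\<bar>Re w\<bar> + \<bar>Im w\<bar> \<le> real n" using real_arch_simple by blast
    then have "w \<in> box n" unfolding in_box by linarith
    then show False using w by simp
  qed
qed

section \<open>Connectedness of the tails\<close>

lemma surface_linked:
  assumes "connectedin surface A" "A \<subseteq> T" "x \<in> A" "y \<in> A"
  shows "connected_component_of (subtopology surface T) x y"
  unfolding connected_component_of_def using assms by (auto simp: connectedin_subtopology)

lemma connectedin_if_linked:
  assumes "T \<subseteq> topspace X"
    and "\<And>x. x \<in> T \<Longrightarrow> connected_component_of (subtopology X T) x p"
  shows "connectedin X T"
proof -
  have "connected_space (subtopology X T)"
    unfolding connected_space_iff_connected_component
    using assms connected_component_of_sym connected_component_of_trans by (metis topspace_subtopology_subset)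
  then show ?thesis
    using assms(1) by (simp add: connectedin_def)
qed

lemma connectedin_fin_pt: "connected S \<Longrightarrow> S \<inter> cset = {} \<Longrightarrow> connectedin surface (fin_pt ` S)"
  using surface.connectedin_chart_image[of S Main] by (auto simp: image_def)

lemma connectedin_Pruefer: "connected S \<Longrightarrow> connectedin surface (schart (Pruefer k) ` S)"
  by (rule surface.connectedin_chart_image) auto

lemma schart_Pruefer_eq_fin_pt: "Im w > 0 \<Longrightarrow> schart (Pruefer k) w = fin_pt (wedge k w)"
  and schart_Pruefer_eq_pr_pt: "Im w \<le> 0 \<Longrightarrow> schart (Pruefer k) w = pr_pt k w"
  by simp_all

lemma in_vertical_segment:
  assumes "a \<le> b"
  shows "u \<in> closed_segment (Complex x a) (Complex x b) \<longleftrightarrow> Re u = x \<and> a \<le> Im u \<and> Im u \<le> b"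
  using assms by (auto simp: closed_segment_same_Re closed_segment_eq_real_ivl)

text \<open>Links half-planes to the planar part. A short piece of the ray stays in the disc by
  continuity. The slope condition is just \<open>\<bar>x\<bar> > a\<close> if \<open>k' = k\<close>;
  otherwise it holds near \<open>cpoint k'\<close> because that point differs from
  \<open>cpoint k\<close>.\<close>

lemma wedge_enters_tail:
  assumes "complex_of_real (cpoint k') \<in> disc k n" and "k' \<noteq> k \<or> \<bar>x\<bar> > a"
  obtains t where "t > 0"
    "\<And>s. 0 < s \<Longrightarrow> s \<le> t \<Longrightarrow> wedge k' (Complex x s) \<in> disc k n
       \<and> \<bar>Re (wedge k' (Complex x s)) - cpoint k\<bar> > a * s"
proof -
  have cont: "continuous_on UNIV (\<lambda>s. wedge k' (Complex x s))"
    by (rule continuous_on_compose2[OF continuous_wedge[of UNIV]]) (auto simp: Complex_eq intro!: continuous_intros)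
  define V where "V = {s. wedge k' (Complex x s) \<in> disc k n}"
  have "open V"
    using continuous_open_preimage[OF cont open_UNIV, of "disc k n"] by (simp add: V_def vimage_def disc_def)
  moreover have "0 \<in> V" using assms(1) by (simp add: V_def wedge_nonpos)
  ultimately obtain d1 where d1: "d1 > 0" "ball 0 d1 \<subseteq> V" using openE by blast
  have "\<exists>d>0. \<forall>s. 0 < s \<and> s < d \<longrightarrow> \<bar>Re (wedge k' (Complex x s)) - cpoint k\<bar> > a * s"
  proof (cases "k' = k")
    case True
    then have "\<bar>Re (wedge k' (Complex x s)) - cpoint k\<bar> > a * s" if "0 < s" for s
      using assms(2) that by (simp add: Re_wedge abs_mult mult.commute)
    then show ?thesis by (intro exI[of _ 1]) simp
  next
    case False
    then have ne: "cpoint k' \<noteq> cpoint k" using inj_cpoint by (simp add: inj_eq)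
    define W where "W = {s. a * s < \<bar>Re (wedge k' (Complex x s)) - cpoint k\<bar>}"
    have "open W"
      unfolding W_def by (intro open_Collect_less continuous_intros cont)
    moreover have "0 \<in> W" using ne by (simp add: W_def wedge_nonpos)
    ultimately obtain d where d: "d > 0" "ball 0 d \<subseteq> W" using openE by blast
    have "\<bar>Re (wedge k' (Complex x s)) - cpoint k\<bar> > a * s" if "0 < s" "s < d" for s
    proof -
      have "s \<in> ball 0 d" using that by (simp add: dist_real_def)
      then show ?thesis using d(2) by (auto simp: W_def)
    qed
    then show ?thesis using d(1) by blast
  qed
  then obtain d2 where d2: "d2 > 0"
    "\<And>s. 0 < s \<Longrightarrow> s < d2 \<Longrightarrow> \<bar>Re (wedge k' (Complex x s)) - cpoint k\<bar> > a * s" by blast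
  show ?thesis
  proof (rule that[of "min d1 d2 / 2"])
    show "min d1 d2 / 2 > 0" using d1(1) d2(1) by simp
    fix s :: real assume s: "0 < s" "s \<le> min d1 d2 / 2"
    have sd: "s < d1" "s < d2" using s d1(1) d2(1) by linarith+
    then have "s \<in> ball 0 d1" using s(1) by (simp add: dist_real_def)
    then have "s \<in> V" using d1(2) by blast
    then show "wedge k' (Complex x s) \<in> disc k n
       \<and> \<bar>Re (wedge k' (Complex x s)) - cpoint k\<bar> > a * s"
      using d2(2) s(1) sd(2) by (simp add: V_def)
  qed
qed

lemma lower_point_in_tail: "fin_pt (Complex (cpart k n) (- (1 / 4 ^ n))) \<in> cell k n - plug k n"
proof -
  have "Complex (cpart k n) (- (1 / 4 ^ n)) \<in> disc k n"
    by (rule Complex_in_disc) (simp add: power_divide divide_strict_right_mono)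
  then show ?thesis
    unfolding fin_pt_in_tail using Im_pos_notin_cset(2) by simp
qed

text \<open>A point of the tail above the real axis lies to the left or to the right of the plugged wedge.
  The vertical line over a point of the disc beyond the Cantor set connects that side to the lower
  half of the disc.\<close>

lemma connectedin_surface_tail: "connectedin surface (cell k n - plug k n)"
proof -
  define T where "T = cell k n - plug k n"
  define a where "a = real n + 3"
  define h where "h = cpoint k"
  define c where "c = cpart k n"
  define e :: real where "e = 1 / 4 ^ n"
  define p where "p = Complex c (- e)"
  define cc where "cc = connected_component_of (subtopology surface T)"
  have e0: "e > 0" and a0: "a \<ge> 3" by (simp_all add: e_def a_def)
  have hc: "\<bar>h - c\<bar> \<le> (4/3) * e"
    using cpoint_cpart[of k n] by (simp add: h_def c_def e_def)
  have inT: "fin_pt z \<in> T \<longleftrightarrow> z \<in> disc k n \<and> z \<notin> cset \<and> (Im z \<le> 0 \<or> \<bar>Re z - h\<bar> > a * Im z)" for z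
    unfolding T_def a_def h_def by (rule fin_pt_in_tail)
  have prT: "pr_pt k' w \<in> T \<longleftrightarrow> Im w \<le> 0 \<and> complex_of_real (cpoint k') \<in> disc k n \<and> (k' \<noteq> k \<or> w \<notin> box n)" for k' w
    unfolding T_def by (rule pr_pt_in_tail)
  have trans: "cc x z" if "cc x y" "cc y z" for x y z
    using that connected_component_of_trans unfolding cc_def by metis
  have inD: "Complex x y \<in> disc k n" if "(x - c)\<^sup>2 + y\<^sup>2 < (2 * e)\<^sup>2" for x y
    using that Complex_in_disc[of x k n y] by (simp add: c_def e_def)
  have convex_disc: "convex (disc k n)" by (simp add: disc_def)
  have pD: "p \<in> disc k n"
    unfolding p_def by (rule inD) (use e0 in \<open>simp add: power_mult_distrib\<close>)
  have plane: "cc (fin_pt z) (fin_pt z')"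
    if "convex S" "z \<in> S" "z' \<in> S" "\<And>u. u \<in> S \<Longrightarrow> fin_pt u \<in> T" for S z z'
    unfolding cc_def
  proof (rule surface_linked)
    have "S \<inter> cset = {}" using that(4) inT by blast
    then show "connectedin surface (fin_pt ` S)"
      using that(1) by (intro connectedin_fin_pt convex_connected)
  qed (use that in auto)
  have lower: "cc (fin_pt z) (fin_pt p)" if "z \<in> disc k n" "Im z < 0" for z
  proof (rule plane)
    show "convex (disc k n \<inter> {u. Im u < 0})"
      by (intro convex_Int convex_disc convex_halfspace_Im_lt)
    show "fin_pt u \<in> T" if "u \<in> disc k n \<inter> {u. Im u < 0}" for u
      using that Im_pos_notin_cset(2) by (auto simp: inT)
  qed (use that pD e0 in \<open>auto simp: p_def\<close>)
  \<comment> \<open>A point of the axis outside the Cantor set drops straight down; the vertical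
    segment meets the axis nowhere else.\<close>
  have axis: "cc (fin_pt z) (fin_pt p)" if z: "z \<in> disc k n" "z \<notin> cset" "Im z = 0" for z
  proof -
    obtain d where d: "d > 0" "ball z d \<subseteq> disc k n"
      using z(1) openE[of "disc k n" z] by (auto simp: disc_def)
    define y where "y = Complex (Re z) (- (d / 2))"
    have "y \<in> ball z d" using d(1) z(3) by (simp add: y_def dist_norm cmod_def)
    then have y: "y \<in> disc k n" using d(2) by blast
    have z': "z = Complex (Re z) 0" using z(3) by (simp add: complex_eq_iff)
    have seg: "u \<in> closed_segment y z \<longleftrightarrow> Re u = Re z \<and> - (d / 2) \<le> Im u \<and> Im u \<le> 0" for u
      unfolding y_def by (subst (2) z') (rule in_vertical_segment, use d(1) in simp)
    have "cc (fin_pt z) (fin_pt y)"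
    proof (rule plane)
      show "fin_pt u \<in> T" if u: "u \<in> closed_segment y z" for u
      proof -
        have "u \<in> disc k n"
          using u closed_segment_subset[OF y z(1) convex_disc] by blast
        moreover have "u \<notin> cset"
        proof
          assume "u \<in> cset"
          then have "Im u = 0" by (rule csetD)
          then have "u = z" using u seg z(3) by (simp add: complex_eq_iff)
          then show False using \<open>u \<in> cset\<close> z(2) by simp
        qed
        ultimately show ?thesis using u seg inT by simp
      qed
    qed auto
    moreover have "cc (fin_pt y) (fin_pt p)"
      by (rule lower[OF y]) (use d(1) in \<open>simp add: y_def\<close>)
    ultimately show ?thesis by (rule trans)
  qed
  have side: "cc (fin_pt z) (fin_pt p)"
    if z: "z \<in> disc k n" "Im z > 0" "\<sigma> * (Re z - h) > a * Im z" and \<sigma>: "\<sigma> = 1 \<or> \<sigma> = -1" for z and \<sigma> :: real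
  proof -
    \<comment> \<open>\<open>7/4\<close> lies between \<open>4/3\<close>, the bound in units of
      \<open>e\<close> for the distance of Cantor points of the disc from \<open>c\<close>, and the
      radius 2. The margin to \<open>h\<close> is at least \<open>7/4 - 4/3 = 5/12\<close>, above
      \<open>a * \<tau> = e / 3\<close>; and \<open>\<tau> \<le> e / 9\<close> keeps the segment in
      the disc, as \<open>49/16 + 1/81 < 4\<close>.\<close>
    define x where "x = c + \<sigma> * ((7/4) * e)"
    define \<tau> where "\<tau> = e / (3 * a)"
    have \<tau>: "\<tau> > 0" "a * \<tau> = e / 3" "\<tau> \<le> e / 9"
      using e0 a0 by (auto simp: \<tau>_def field_simps)
    have xh: "\<sigma> * (x - h) \<ge> (5/12) * e"
      using \<sigma> hc e0 by (auto simp: x_def abs_if split: if_splits)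
    have box: "Complex x y \<in> disc k n" if "\<bar>y\<bar> \<le> \<tau>" for y
    proof (rule inD)
      have "y\<^sup>2 \<le> (e / 9)\<^sup>2"
        using that \<tau>(3) by (intro abs_le_square_iff[THEN iffD1]) auto
      moreover have "(x - c)\<^sup>2 = (49/16) * e\<^sup>2"
        using \<sigma> by (auto simp: x_def power2_eq_square)
      moreover have "e\<^sup>2 > 0" "(2 * e)\<^sup>2 = 4 * e\<^sup>2" "(e / 9)\<^sup>2 = e\<^sup>2 / 81"
        using e0 by (simp_all add: power_divide power_mult_distrib)
      ultimately show "(x - c)\<^sup>2 + y\<^sup>2 < (2 * e)\<^sup>2"
        by linarith
    qed
    have 1: "cc (fin_pt z) (fin_pt (Complex x \<tau>))"
    proof (rule plane)
      \<comment> \<open>One side of the removed cone above the axis, convex as an intersection of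
        half-planes with the disc.\<close>
      let ?S = "disc k n \<inter> ({u. Im u > 0} \<inter> {u. Complex \<sigma> (- a) \<bullet> u > \<sigma> * h})"
      show "convex ?S"
        by (intro convex_Int convex_disc convex_halfspace_Im_gt convex_halfspace_gt)
      have S: "u \<in> ?S \<longleftrightarrow> u \<in> disc k n \<and> Im u > 0 \<and> \<sigma> * (Re u - h) > a * Im u" for u
        by (auto simp: inner_complex_def algebra_simps)
      show "z \<in> ?S" unfolding S using z by simp
      show "Complex x \<tau> \<in> ?S" unfolding S using box[of \<tau>] xh \<tau> e0 by simp
      show "fin_pt u \<in> T" if "u \<in> ?S" for u
      proof -
        have u: "u \<in> disc k n" "Im u > 0" "\<sigma> * (Re u - h) > a * Im u" using that unfolding S by auto
        have "\<sigma> * (Re u - h) \<le> \<bar>Re u - h\<bar>" using \<sigma> by auto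
        then show ?thesis using u Im_pos_notin_cset(1) by (auto simp: inT)
      qed
    qed
    have 2: "cc (fin_pt (Complex x \<tau>)) (fin_pt (Complex x (- \<tau>)))"
    proof (rule plane)
      show "fin_pt u \<in> T" if "u \<in> closed_segment (Complex x (- \<tau>)) (Complex x \<tau>)" for u
      proof -
        have u: "Re u = x" "\<bar>Im u\<bar> \<le> \<tau>"
          using that in_vertical_segment[of "- \<tau>" \<tau> u x] \<tau>(1) by auto
        then have "u = Complex x (Im u)" by (simp add: complex_eq_iff)
        then have uD: "u \<in> disc k n" using box u(2) by metis
        moreover have "u \<notin> cset"
        proof
          assume "u \<in> cset"
          then obtain k' where k': "u = complex_of_real (cpoint k')" by (auto simp: cset_def)
          \<comment> \<open>Cantor points of the disc share the first \<open>n\<close> digits with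
            \<open>k\<close>, so they lie too close to \<open>c\<close> to have real part
            \<open>x\<close>.\<close>
          then have "cpart k' n = cpart k n"
            using cpoint_in_discD uD by (intro cpart_cong) blast
          then have "\<bar>x - c\<bar> \<le> (4/3) * e"
            using cpoint_cpart[of k' n] k' u(1) by (simp add: c_def e_def)
          then show False using \<sigma> e0 by (auto simp: x_def)
        qed
        moreover have "\<bar>Re u - h\<bar> > a * Im u"
        proof -
          have "a * Im u \<le> a * \<tau>" using u(2) a0 by (intro mult_left_mono) auto
          moreover have "\<sigma> * (x - h) \<le> \<bar>x - h\<bar>" using \<sigma> by auto
          ultimately show ?thesis using \<tau>(2) xh e0 u(1) by simp
        qed
        ultimately show ?thesis by (simp add: inT)
      qed
    qed auto
    have 3: "cc (fin_pt (Complex x (- \<tau>))) (fin_pt p)"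
      using box[of "- \<tau>"] \<tau>(1) by (intro lower) auto
    show ?thesis using trans[OF 1 trans[OF 2 3]] .
  qed
  have fin: "cc (fin_pt z) (fin_pt p)" if "fin_pt z \<in> T" for z
  proof -
    have z: "z \<in> disc k n" "z \<notin> cset" "Im z \<le> 0 \<or> \<bar>Re z - h\<bar> > a * Im z"
      using that by (auto simp: inT)
    show ?thesis
    proof (cases "Im z > 0")
      case True
      then have "1 * (Re z - h) > a * Im z \<or> (-1) * (Re z - h) > a * Im z"
        using z(3) by (cases "Re z < h") auto
      then show ?thesis
        using side[of z 1] side[of z "-1"] z(1) True by blast
    next
      case False
      then consider "Im z < 0" | "Im z = 0" by linarith
      then show ?thesis
        by cases (use z lower axis in auto)
    qed
  qed
  have pr: "cc (pr_pt k' w) (fin_pt p)"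
    if w: "Im w \<le> 0" "complex_of_real (cpoint k') \<in> disc k n" "k' \<noteq> k \<or> \<bar>Re w\<bar> > a" for k' w
  proof -
    obtain t where t: "t > 0"
      "\<And>s. 0 < s \<Longrightarrow> s \<le> t \<Longrightarrow> wedge k' (Complex (Re w) s) \<in> disc k n
         \<and> \<bar>Re (wedge k' (Complex (Re w) s)) - cpoint k\<bar> > a * s"
      using wedge_enters_tail[OF w(2,3)] by blast
    have w': "w = Complex (Re w) (Im w)" by simp
    \<comment> \<open>In the chart, a vertical line from \<open>w\<close> up into the upper
      half-plane, where \<open>wedge_enters_tail\<close> keeps it in the tail.\<close>
    let ?S = "closed_segment (Complex (Re w) (Im w)) (Complex (Re w) t)"
    have S: "u \<in> ?S \<longleftrightarrow> Re u = Re w \<and> Im w \<le> Im u \<and> Im u \<le> t" for u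
      by (rule in_vertical_segment) (use w(1) t(1) in simp)
    have ST: "schart (Pruefer k') u \<in> T" if u: "u \<in> ?S" for u
    proof (cases "Im u > 0")
      case True
      have "u = Complex (Re w) (Im u)" using u S by (simp add: complex_eq_iff)
      then have "wedge k' u \<in> disc k n \<and> \<bar>Re (wedge k' u) - h\<bar> > a * Im u"
        using t(2)[of "Im u"] True u S by (simp add: h_def)
      moreover have "Im (wedge k' u) = Im u" using True by (simp add: Im_wedge)
      ultimately show ?thesis
        using True Im_pos_notin_cset(1) by (simp only: schart_Pruefer_eq_fin_pt inT) auto
    next
      case False
      then have "k' \<noteq> k \<or> u \<notin> box n" using w(3) u S by (auto simp: in_box a_def)
      then show ?thesis using False w(2) by (simp add: prT)
    qed
    have wS: "w \<in> ?S" "Complex (Re w) t \<in> ?S" by simp_all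
    have "cc (schart (Pruefer k') w) (schart (Pruefer k') (Complex (Re w) t))"
      unfolding cc_def
      by (rule surface_linked[of "schart (Pruefer k') ` ?S"])
        (use ST wS in \<open>auto simp del: schart.simps intro!: connectedin_Pruefer\<close>)
    moreover have "cc (schart (Pruefer k') (Complex (Re w) t)) (fin_pt p)"
      using ST[OF wS(2)] fin t(1) by simp
    ultimately show ?thesis
      using trans w(1) schart_Pruefer_eq_pr_pt by metis
  qed
  have all: "cc x (fin_pt p)" if x: "x \<in> T" for x
  proof -
    have "x \<in> topspace surface"
      using x over_subset by (auto simp: T_def cell_def)
    then show ?thesis
    proof (cases rule: surface_cases)
      case (1 z)
      then show ?thesis using fin x by simp
    next
      case 2
      then show ?thesis using x inf_pt_notin_tail[of k n] by (simp add: T_def)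
    next
      case (3 k' w)
      then have w: "Im w \<le> 0" "complex_of_real (cpoint k') \<in> disc k n" "k' \<noteq> k \<or> w \<notin> box n"
        using x prT by auto
      show ?thesis
      proof (cases "k' \<noteq> k \<or> \<bar>Re w\<bar> > a")
        case True
        then show ?thesis using pr w 3 by simp
      next
        case False
        then have ww: "k' = k" "\<bar>Re w\<bar> \<le> a" "Im w < - a"
          using w by (auto simp: in_box a_def)
        \<comment> \<open>Here \<open>w\<close> lies below the box. As \<open>Im w < - a\<close>, a
          horizontal move passes under the box to real part \<open>a + 1\<close>, where
          \<open>pr\<close> applies.\<close>
        define v where "v = Complex (a + 1) (Im w)"
        have "cc (pr_pt k w) (pr_pt k v)"
          unfolding cc_def
        proof (rule surface_linked)
          show "connectedin surface (schart (Pruefer k) ` closed_segment w v)"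
            by (intro connectedin_Pruefer) simp
          have Im: "Im u = Im w" if "u \<in> closed_segment w v" for u
            using that by (auto simp: closed_segment_same_Im v_def)
          have "schart (Pruefer k) u \<in> T" if "u \<in> closed_segment w v" for u
            using Im[OF that] ww w(1,2) by (simp add: prT in_box a_def)
          then show "schart (Pruefer k) ` closed_segment w v \<subseteq> T" by blast
          show "pr_pt k w \<in> schart (Pruefer k) ` closed_segment w v"
            "pr_pt k v \<in> schart (Pruefer k) ` closed_segment w v"
            unfolding pr_pt_in_schart_image using w(1) by (simp_all add: v_def)
        qed
        moreover have "cc (pr_pt k v) (fin_pt p)"
          using w ww a0 by (intro pr) (auto simp: v_def)
        ultimately show ?thesis using trans 3 ww(1) by simp
      qed
    qed
  qed
  have "T \<subseteq> topspace surface"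
    using over_subset by (auto simp: T_def cell_def)
  then have "connectedin surface T"
    using all unfolding cc_def by (rule connectedin_if_linked)
  then show ?thesis by (simp add: T_def)
qed

interpretation surface: cantor_tails surface cell plug
proof
  show "Hausdorff_space surface" by (rule Hausdorff_surface)
  fix k k' :: "nat \<Rightarrow> bool" and n i :: nat
  show "openin surface (cell k n)" by (simp add: cell_def disc_def openin_over)
  show "surface closure_of cell k (Suc n) \<subseteq> cell k n" by (rule closure_cell_Suc)
  show "(\<And>i. i < n \<Longrightarrow> k i = k' i) \<Longrightarrow> cell k n = cell k' n"
    using cpart_cong[of n k k'] by (simp add: cell_def disc_def)
  show "i < n \<Longrightarrow> k i \<noteq> k' i \<Longrightarrow> disjnt (surface closure_of cell k n) (surface closure_of cell k' n)"
    by (rule disjnt_closure_cell)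
  show "compactin surface (topspace surface - (\<Union>k. cell k n))" by (rule compactin_compl_cells)
  show "compactin surface (plug k n)"
    unfolding plug_def by (rule surface.compactin_chart_image) (simp_all add: box_def)
  show "plug k n \<subseteq> surface interior_of plug k (Suc n)" by (rule plug_Suc)
  show "connectedin surface (cell k n - plug k n)" by (rule connectedin_surface_tail)
  show "cell k n - plug k n \<noteq> {}" using lower_point_in_tail by blast
  show "(\<Inter>n. cell k n - plug k n) = {}" by (rule Inter_tails_empty)
qed

section \<open>The surface is a non-metrizable manifold\<close>

lemma connected_surface: "connected_space surface"
proof -
  define cc where "cc = connected_component_of surface"
  define p where "p = Complex 0 (- 1)"
  have trans: "cc x z" if "cc x y" "cc y z" for x y z
    using that connected_component_of_trans unfolding cc_def by metis
  have link: "cc x y" if "connectedin surface A" "x \<in> A" "y \<in> A" for A x y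
    unfolding cc_def connected_component_of_def using that by blast
  have plane: "cc (fin_pt z) (fin_pt z')" if "convex S" "S \<inter> cset = {}" "z \<in> S" "z' \<in> S" for S z z'
    using that by (intro link[of "fin_pt ` S"] connectedin_fin_pt convex_connected) auto
  have lower: "cc (fin_pt z) (fin_pt p)" if "Im z < 0" for z
    using that Im_pos_notin_cset(2)
    by (intro plane[of "{u. Im u < 0}"] convex_halfspace_Im_lt) (auto simp: p_def)
  have axis: "cc (fin_pt z) (fin_pt p)" if z: "z \<notin> cset" "Im z = 0" for z
  proof -
    have z': "z = Complex (Re z) 0" using z(2) by (simp add: complex_eq_iff)
    have seg: "u \<in> closed_segment (Complex (Re z) (- 1)) z \<longleftrightarrow> Re u = Re z \<and> - 1 \<le> Im u \<and> Im u \<le> 0" for u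
      by (subst (2) z') (rule in_vertical_segment, simp)
    have "closed_segment (Complex (Re z) (- 1)) z \<inter> cset = {}"
    proof (rule ccontr)
      assume "\<not> ?thesis"
      then obtain u where u: "u \<in> cset" "Re u = Re z" using seg by blast
      then have "u = z" using csetD(1)[OF u(1)] z(2) by (simp add: complex_eq_iff)
      then show False using u(1) z(1) by simp
    qed
    then have "cc (fin_pt z) (fin_pt (Complex (Re z) (- 1)))"
      by (intro plane[of "closed_segment (Complex (Re z) (- 1)) z"]) auto
    then show ?thesis
      using lower[of "Complex (Re z) (- 1)"] trans by simp
  qed
  have upper: "cc (fin_pt z) (fin_pt p)" if z: "Im z > 0" for z
  proof -
    have "cc (fin_pt z) (fin_pt (Complex 3 1))"
      using z Im_pos_notin_cset(1)
      by (intro plane[of "{u. Im u > 0}"] convex_halfspace_Im_gt) auto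
    \<comment> \<open>Cantor points have modulus below 2, so the vertical line over 3 crosses the
      axis freely.\<close>
    moreover have "cc (fin_pt (Complex 3 1)) (fin_pt (Complex 3 (- 1)))"
    proof (rule plane[of "closed_segment (Complex 3 (- 1)) (Complex 3 1)"])
      have "u \<notin> cset" if "Re u = 3" for u
        using csetD(2)[of u] abs_Re_le_cmod[of u] that by auto
      then show "closed_segment (Complex 3 (- 1)) (Complex 3 1) \<inter> cset = {}"
        using in_vertical_segment[of "-1" 1 _ 3] by auto
    qed auto
    moreover have "cc (fin_pt (Complex 3 (- 1))) (fin_pt p)"
      by (rule lower) simp
    ultimately show ?thesis using trans by blast
  qed
  have "cc x (fin_pt p)" if "x \<in> topspace surface" for x
    using that
  proof (cases rule: surface_cases)
    case (1 z)
    then show ?thesis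
      using lower[of z] axis[of z] upper[of z] by (cases "Im z" "0::real" rule: linorder_cases) auto
  next
    case 2
    have "connectedin surface (near_inf (1/2))"
      unfolding near_inf_def using ball_subset_sdom_AtInf
      by (intro surface.connectedin_chart_image) auto
    then have "cc inf_pt (fin_pt (Complex 0 3))"
      by (rule link) (simp_all add: cmod_def)
    then show ?thesis using 2 upper[of "Complex 0 3"] trans by simp
  next
    case (3 k w)
    have "connectedin surface (range (schart (Pruefer k)))"
      by (rule connectedin_Pruefer) (rule connected_UNIV)
    then have "cc (pr_pt k w) (fin_pt (Complex 0 1))"
      by (rule link) (use 3(2) in \<open>simp_all only: pr_pt_in_schart_image fin_pt_in_schart_image, simp_all\<close>)
    then show ?thesis using 3 upper[of "Complex 0 1"] trans by simp
  qed
  then have "connectedin surface (topspace surface)"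
    unfolding cc_def by (intro connectedin_if_linked) auto
  then show ?thesis by (simp add: connectedin_topspace)
qed

lemma manifold_surface: "manifold_space surface"
  unfolding manifold_space_def
  using connected_surface Hausdorff_surface surface.glued_locally_Euclidean
  by (intro conjI exI[of _ "2::nat"]) auto

section \<open>Non-metrizability\<close>

lemma uncountable_nat_bool: "uncountable (UNIV :: (nat \<Rightarrow> bool) set)"
proof
  assume "countable (UNIV :: (nat \<Rightarrow> bool) set)"
  then obtain f :: "nat \<Rightarrow> nat \<Rightarrow> bool" where f: "range f = UNIV"
    using range_from_nat_into[of "UNIV :: (nat \<Rightarrow> bool) set"] by blast
  then obtain n where "f n = (\<lambda>i. \<not> f i i)" by (metis UNIV_I imageE)
  then show False by metis
qed

text \<open>Countably many points of the upper half-plane accumulate at all of the points \<open>pr_pt k 0\<close>, which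
  form an uncountable discrete set; this is impossible in a metric space.\<close>

lemma dense_near_pr_pt:
  assumes Q: "\<And>G. open G \<Longrightarrow> G \<noteq> {} \<Longrightarrow> \<exists>q\<in>Q. q \<in> G"
    and W: "openin surface W" "pr_pt k 0 \<in> W"
  shows "\<exists>q\<in>Q. fin_pt q \<in> W"
proof -
  define G where "G = {w. schart (Pruefer k) w \<in> W}"
  have "open {w \<in> sdom (Pruefer k). schart (Pruefer k) w \<in> W}"
    using W(1) unfolding surface.openin_glued by blast
  then have "open G" by (simp add: G_def)
  moreover have "0 \<in> G" using W(2) by (simp add: G_def)
  ultimately obtain d where d: "d > 0" "ball 0 d \<subseteq> G" using openE by blast
  \<comment> \<open>This point shows that the open set on the right is nonempty; density then
    supplies \<open>q\<close>.\<close>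
  have "wedge k (Complex 0 (d / 2)) \<in> {z. Im z > 0 \<and> unwedge k z \<in> G}"
  proof -
    have "Complex 0 (d / 2) \<in> G" using d by (auto simp: cmod_def intro!: subsetD[OF d(2)])
    moreover have "unwedge k (wedge k (Complex 0 (d / 2))) = Complex 0 (d / 2)"
      using wedge_eq_iff[of "Complex 0 (d / 2)" k "wedge k (Complex 0 (d / 2))"] d(1) by simp
    ultimately show ?thesis using d(1) by (simp add: Im_wedge)
  qed
  then obtain q where q: "q \<in> Q" "Im q > 0" "unwedge k q \<in> G"
    using Q[OF open_unwedge_preimage[OF \<open>open G\<close>, of k]] by blast
  then have "fin_pt q \<in> W"
    using wedge_unwedge[of q k] by (simp add: G_def)
  then show ?thesis using q(1) by blast
qed

text \<open>Each \<open>k\<close> receives a natural number \<open>m\<close> and a point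
  \<open>q\<close> of a countable dense set. Equal pairs for \<open>k\<close> and \<open>k'\<close>
  bring \<open>pr_pt k' 0\<close> within \<open>2 / real (Suc m)\<close> of
  \<open>pr_pt k 0\<close>, hence into the chart of \<open>k\<close>, which forces
  \<open>k' = k\<close>. Uncountably many sequences would thus inject into a countable set.\<close>

lemma not_metrizable_surface: "\<not> metrizable_space surface"
proof
  assume "metrizable_space surface"
  then obtain M d where "Metric_space M d" and top: "surface = Metric_space.mtopology M d"
    unfolding metrizable_space_def by blast
  then interpret Metric_space M d by simp
  obtain Q :: "complex set" where Q: "countable Q" "\<And>G. open G \<Longrightarrow> G \<noteq> {} \<Longrightarrow> \<exists>q\<in>Q. q \<in> G"
    using countable_dense_setE by metis
  have "\<exists>m q. q \<in> Q \<and> fin_pt q \<in> mball (pr_pt k 0) (1 / real (Suc m)) \<and>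
          mball (pr_pt k 0) (2 / real (Suc m)) \<subseteq> range (schart (Pruefer k))" for k
  proof -
    have "openin surface (range (schart (Pruefer k)))"
      using surface.openin_chart_image[of UNIV "Pruefer k"] by simp
    moreover have "pr_pt k 0 \<in> range (schart (Pruefer k))"
      by (simp only: pr_pt_in_schart_image) simp
    ultimately obtain r where r: "r > 0" "mball (pr_pt k 0) r \<subseteq> range (schart (Pruefer k))"
      unfolding top openin_mtopology by blast
    obtain m where m: "1 / real (Suc m) < r / 2"
      using reals_Archimedean[of "r / 2"] r(1) by (auto simp: inverse_eq_divide)
    then have "mball (pr_pt k 0) (2 / real (Suc m)) \<subseteq> mball (pr_pt k 0) r"
      by (intro mball_subset_concentric) (simp add: field_simps)
    moreover have "pr_pt k 0 \<in> M"
      using pr_pt_in_surface[of k 0] unfolding top by simp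
    then have "\<exists>q\<in>Q. fin_pt q \<in> mball (pr_pt k 0) (1 / real (Suc m))"
      by (intro dense_near_pr_pt[OF Q(2)]) (auto simp: top)
    ultimately show ?thesis using r(2) by blast
  qed
  then obtain m q where mq: "\<And>k. q k \<in> Q"
    "\<And>k. fin_pt (q k) \<in> mball (pr_pt k 0) (1 / real (Suc (m k)))"
    "\<And>k. mball (pr_pt k 0) (2 / real (Suc (m k))) \<subseteq> range (schart (Pruefer k))" by metis
  have "inj (\<lambda>k. (m k, q k))"
  proof (rule injI)
    fix k k' assume eq: "(m k, q k) = (m k', q k')"
    have a: "pr_pt k 0 \<in> M" "pr_pt k' 0 \<in> M" "fin_pt (q k) \<in> M"
      "d (pr_pt k 0) (fin_pt (q k)) < 1 / real (Suc (m k))"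
      "d (pr_pt k' 0) (fin_pt (q k)) < 1 / real (Suc (m k))"
      using mq(2)[of k] mq(2)[of k'] eq by auto
    then have "d (pr_pt k 0) (pr_pt k' 0) < 1 / real (Suc (m k)) + 1 / real (Suc (m k))"
      using triangle[of "pr_pt k 0" "fin_pt (q k)" "pr_pt k' 0"] commute[of "fin_pt (q k)" "pr_pt k' 0"] by linarith
    then have "pr_pt k' 0 \<in> mball (pr_pt k 0) (2 / real (Suc (m k)))"
      using a by simp
    then have "pr_pt k' 0 \<in> range (schart (Pruefer k))"
      using mq(3) by blast
    then show "k = k'" by (simp only: pr_pt_in_schart_image) simp
  qed
  moreover have "range (\<lambda>k. (m k, q k)) \<subseteq> UNIV \<times> Q" using mq(1) by auto
  then have "countable (range (\<lambda>k. (m k, q k)))"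
    by (rule countable_subset) (simp add: Q(1))
  ultimately show False
    using uncountable_nat_bool countable_image_inj_on by blast
qed

lemma second_countable_Cantor_space: "second_countable Cantor_space"
proof -
  define C :: "bool list \<Rightarrow> (nat \<Rightarrow> bool) set" where "C xs = {k. \<forall>i<length xs. k i = xs ! i}" for xs
  have "openin Cantor_space (C xs)" for xs
    unfolding C_def by (rule openin_cylinder)
  moreover have "\<exists>xs. k \<in> C xs \<and> C xs \<subseteq> U" if U: "openin Cantor_space U" "k \<in> U" for U k
  proof -
    obtain V where V: "finite {i. V i \<noteq> UNIV}" "k \<in> Pi\<^sub>E UNIV V" "Pi\<^sub>E UNIV V \<subseteq> U"
      using U by (fastforce simp: Cantor_space_def openin_product_topology_alt)
    obtain n where "\<forall>i\<in>{i. V i \<noteq> UNIV}. i < n"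
      using V(1) unfolding finite_nat_set_iff_bounded by (rule exE)
    then have n: "V i \<noteq> UNIV \<Longrightarrow> i < n" for i by simp
    have "k' \<in> Pi\<^sub>E UNIV V" if "k' \<in> C (map k [0..<n])" for k'
    proof -
      have "k' i \<in> V i" for i
        using that V(2) n[of i] by (cases "i < n") (auto simp: C_def PiE_iff)
      then show ?thesis by (simp add: PiE_iff)
    qed
    then have "C (map k [0..<n]) \<subseteq> U" using V(3) by blast
    moreover have "k \<in> C (map k [0..<n])" by (simp add: C_def)
    ultimately show ?thesis by blast
  qed
  ultimately show ?thesis
    unfolding second_countable_def by (intro exI[of _ "range C"]) simp
qed

(* Every manifold (with more than one point) has the cardinality of the continuum, so it is
   homeomorphic to one whose points are elements of nat \<Rightarrow> real; letting M range over topologies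
   with arbitrary carriers in this type is no restriction. The topology that the type nat \<Rightarrow> real
   itself carries plays no role. *)

theorem theoremB1:
  shows "\<exists>M :: (nat \<Rightarrow> real) topology.
           manifold_space M \<and> \<not> metrizable_space M \<and>
           (\<forall>e\<in>ends M. short_end M e) \<and>
           second_countable (end_space M) \<and>
           end_space M homeomorphic_space Cantor_space"
proof (intro exI conjI)
  show "manifold_space surface" by (rule manifold_surface)
  show "\<not> metrizable_space surface" by (rule not_metrizable_surface)
  show "\<forall>e\<in>ends surface. short_end surface e" by (intro ballI surface.short_ends)
  show "end_space surface homeomorphic_space Cantor_space" by (rule surface.end_space_homeomorphic_Cantor)
  then have "second_countable (end_space surface) \<longleftrightarrow> second_countable Cantor_space"
    by (rule homeomorphic_space_second_countability)
  then show "second_countable (end_space surface)"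
    by (simp only: second_countable_Cantor_space)
qed

end
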